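(* Let $n\ge 2$ be an integer, let $\mathcal{U}$ be an arbitrary von Neumann algebra with center $\mathrm{Z}(\mathcal{U})$, and let $\phi:\mathcal{U}\to\mathcal{U}$ be an additive map. Then $\phi$ is a Lie $n$-centralizer, i.e. $\phi(p_n(A_1,A_2,\ldots,A_n))=p_n(\phi(A_1),A_2,\ldots,A_n)$ for all $A_1,\ldots,A_n\in\mathcal{U}$, if and only if there exist an element $W\in\mathrm{Z}(\mathcal{U})$ and an additive map $\xi:\mathcal{U}\to\mathrm{Z}(\mathcal{U})$ such that $\phi(A)=WA+\xi(A)$ for all $A\in\mathcal{U}$ and $\xi(p_n(A_1,A_2,\ldots,A_n))=0$ for all $A_1,A_2,\ldots,A_n\in\mathcal{U}$.
   Context: A von Neumann algebra is a weakly closed, self-adjoint algebra of bounded operators on a complex Hilbert space containing the identity operator. $[A,B]=AB-BA$; $p_1(A_1)=A_1$ and $p_n(A_1,\ldots,A_n)=[p_{n-1}(A_1,\ldots,A_{n-1}),A_n]$ for $n\ge 2$. *)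

theory Defs
  imports "HOL-Analysis.Analysis"
begin

text \<open>
  Complex Hilbert spaces. The library only has real inner product spaces, so the complex scalar
  multiplication and the sesquilinear form (linear in the first argument) are added on top of the
  real Banach space structure. Positive definiteness of \<open>cinner\<close> and the law \<open>1 *\<^sub>C x = x\<close> follow
  from \<open>cinner_self\<close> and \<open>scaleR_scaleC\<close>.
\<close>

class complex_hilbert_space = banach +
  fixes scaleC :: "complex \<Rightarrow> 'a \<Rightarrow> 'a" (infixr "*\<^sub>C" 75)
    and cinner :: "'a \<Rightarrow> 'a \<Rightarrow> complex"
  assumes scaleC_add_right: "c *\<^sub>C (x + y) = c *\<^sub>C x + c *\<^sub>C y"
    and scaleC_add_left: "(c + d) *\<^sub>C x = c *\<^sub>C x + d *\<^sub>C x"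
    and scaleC_scaleC: "c *\<^sub>C (d *\<^sub>C x) = (c * d) *\<^sub>C x"
    and scaleR_scaleC: "scaleR r x = complex_of_real r *\<^sub>C x"
    and cinner_commute: "cinner x y = cnj (cinner y x)"
    and cinner_add_left: "cinner (x + y) z = cinner x z + cinner y z"
    and cinner_scaleC_left: "cinner (c *\<^sub>C x) y = c * cinner x y"
    and cinner_self: "cinner x x = complex_of_real ((norm x)\<^sup>2)"

text \<open>
  The type \<open>'h \<Rightarrow>\<^sub>L 'h\<close> consists of the bounded real-linear operators, so \<open>B(H)\<close> is
  its subset of complex-linear ones.
\<close>

definition bounded_operators :: "('h::complex_hilbert_space \<Rightarrow>\<^sub>L 'h) set" where
  "bounded_operators = {A. \<forall>c x. blinfun_apply A (c *\<^sub>C x) = c *\<^sub>C blinfun_apply A x}"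

definition scaleC_op :: "complex \<Rightarrow> ('h::complex_hilbert_space \<Rightarrow>\<^sub>L 'h) \<Rightarrow> ('h \<Rightarrow>\<^sub>L 'h)" where
  "scaleC_op c A = Blinfun (\<lambda>x. c *\<^sub>C blinfun_apply A x)"

lemma norm_scaleC: "norm (c *\<^sub>C x) = cmod c * norm (x::'h::complex_hilbert_space)"
proof -
  have "complex_of_real ((norm (c *\<^sub>C x))\<^sup>2) = c * cnj c * complex_of_real ((norm x)\<^sup>2)"
    by (metis cinner_commute cinner_scaleC_left cinner_self complex_cnj_complex_of_real
        complex_cnj_mult mult.assoc)
  also have "\<dots> = complex_of_real ((cmod c * norm x)\<^sup>2)"
    by (simp only: complex_norm_square [symmetric] power_mult_distrib of_real_mult)
  finally have "(norm (c *\<^sub>C x))\<^sup>2 = (cmod c * norm x)\<^sup>2"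
    by (simp only: of_real_eq_iff)
  then show ?thesis
    by (simp add: power2_eq_iff_nonneg)
qed

lemma bounded_linear_scaleC: "bounded_linear (\<lambda>x::'h::complex_hilbert_space. c *\<^sub>C x)"
  by (rule bounded_linear_intro[where K = "cmod c"])
    (simp_all add: scaleC_add_right scaleR_scaleC scaleC_scaleC norm_scaleC mult.commute)

lemma scaleC_op_apply [simp]: "blinfun_apply (scaleC_op c A) x = c *\<^sub>C blinfun_apply A x"
  unfolding scaleC_op_def
  by (subst bounded_linear_Blinfun_apply)
    (auto intro: bounded_linear_compose[OF bounded_linear_scaleC blinfun.bounded_linear_right])

definition is_adjoint :: "('h::complex_hilbert_space \<Rightarrow>\<^sub>L 'h) \<Rightarrow> ('h \<Rightarrow>\<^sub>L 'h) \<Rightarrow> bool" where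
  "is_adjoint A B \<longleftrightarrow> (\<forall>x y. cinner (blinfun_apply A x) y = cinner x (blinfun_apply B y))"

text \<open>
  The coarsest topology on \<open>B(H)\<close> making all maps \<open>A \<mapsto> \<langle>A x, y\<rangle>\<close> continuous; the
  functions \<open>'h \<times> 'h \<Rightarrow> complex\<close> carry the product topology.
\<close>

definition weak_operator_topology :: "('h::complex_hilbert_space \<Rightarrow>\<^sub>L 'h) topology" where
  "weak_operator_topology =
     pullback_topology bounded_operators (\<lambda>A (x, y). cinner (blinfun_apply A x) y) euclidean"

definition von_neumann_algebra :: "('h::complex_hilbert_space \<Rightarrow>\<^sub>L 'h) set \<Rightarrow> bool" where
  "von_neumann_algebra U \<longleftrightarrow>
     U \<subseteq> bounded_operators \<and>
     id_blinfun \<in> U \<and>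
     (\<forall>A\<in>U. \<forall>B\<in>U. A + B \<in> U) \<and>
     (\<forall>c. \<forall>A\<in>U. scaleC_op c A \<in> U) \<and>
     (\<forall>A\<in>U. \<forall>B\<in>U. A o\<^sub>L B \<in> U) \<and>
     (\<forall>A\<in>U. \<exists>B\<in>U. is_adjoint A B) \<and>
     closedin weak_operator_topology U"

definition center :: "('h::complex_hilbert_space \<Rightarrow>\<^sub>L 'h) set \<Rightarrow> ('h \<Rightarrow>\<^sub>L 'h) set" where
  "center U = {Z\<in>U. \<forall>A\<in>U. Z o\<^sub>L A = A o\<^sub>L Z}"

definition commutator :: "('h::complex_hilbert_space \<Rightarrow>\<^sub>L 'h) \<Rightarrow> ('h \<Rightarrow>\<^sub>L 'h) \<Rightarrow> ('h \<Rightarrow>\<^sub>L 'h)" where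
  "commutator A B = (A o\<^sub>L B) - (B o\<^sub>L A)"

text \<open>
  \<open>lie_poly n A\<close> is \<open>p\<^sub>n(A\<^sub>1, \<dots>, A\<^sub>n)\<close> for the tuple given by the values of \<open>A\<close> at \<open>1, \<dots>, n\<close>.
  The equation for \<open>n = 0\<close> is a dummy.
\<close>

fun lie_poly :: "nat \<Rightarrow> (nat \<Rightarrow> ('h::complex_hilbert_space \<Rightarrow>\<^sub>L 'h)) \<Rightarrow> ('h \<Rightarrow>\<^sub>L 'h)" where
  "lie_poly 0 A = 0"
| "lie_poly (Suc 0) A = A 1"
| "lie_poly (Suc (Suc n)) A = commutator (lie_poly (Suc n) A) (A (Suc (Suc n)))"

definition additive_map ::
  "('h::complex_hilbert_space \<Rightarrow>\<^sub>L 'h) set \<Rightarrow> ('h \<Rightarrow>\<^sub>L 'h) set \<Rightarrow> (('h \<Rightarrow>\<^sub>L 'h) \<Rightarrow> ('h \<Rightarrow>\<^sub>L 'h)) \<Rightarrow> bool"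
  where
  "additive_map U V f \<longleftrightarrow> f \<in> U \<rightarrow> V \<and> (\<forall>A\<in>U. \<forall>B\<in>U. f (A + B) = f A + f B)"

definition lie_centralizer ::
  "nat \<Rightarrow> ('h::complex_hilbert_space \<Rightarrow>\<^sub>L 'h) set \<Rightarrow> (('h \<Rightarrow>\<^sub>L 'h) \<Rightarrow> ('h \<Rightarrow>\<^sub>L 'h)) \<Rightarrow> bool"
  where
  "lie_centralizer n U \<phi> \<longleftrightarrow>
     (\<forall>A. (\<forall>i\<in>{1..n}. A i \<in> U) \<longrightarrow> \<phi> (lie_poly n A) = lie_poly n (A(1 := \<phi> (A 1))))"

end

theory Submission
  imports Defs
begin

text \<open>
  A commutator that is central in a von Neumann algebra vanishes (Kleinecke--Shirokov). Swapping the
  first two arguments of \<open>p\<^sub>n\<close> therefore shows that a Lie \<open>n\<close>-centralizer satisfies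
  \<open>[\<phi> X, Y] = [X, \<phi> Y]\<close>. Such a map is bounded modulo the center by Baire's theorem, and
  \<open>[\<phi> X, Y] [V, Z] = [X, Y] [\<phi> V, Z]\<close>. So \<open>[X, Y] h \<mapsto> [\<phi> X, Y] h\<close> is a well-defined multiplier, symmetric
  if \<open>\<phi>\<close> is self-adjoint, and bounded because its powers grow at most geometrically. Approximate
  units made of commutators show that this multiplier \<open>W\<close> belongs to the algebra. The commutator
  \<open>[W, Y]\<close> annihilates all commutators, in particular its own adjoint, so \<open>W\<close> is central, and
  \<open>[\<phi> X - W X, Y] = [\<phi> X, Y] - W [X, Y] = 0\<close>.
\<close>

section \<open>Complex Hilbert spaces\<close>

text \<open>No continuity of \<open>\<phi>\<close> is available, and on an abelian \<open>U\<close>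
  every additive self-map is a Lie n-centralizer, so \<open>\<phi> X\<close> can only be controlled
  through its brackets, that is modulo the center. Baire's theorem is therefore applied not to the
  graph of \<open>\<phi>\<close> but to the pairs (X, W) with [W, Y] = [X, \<open>\<phi>\<close> Y]
  for all Y, a closed real-linear relation. The resulting estimate for the m-th iterate on a vector
  s = sum [X_i, Y_i] h_i has the form K C^m, where K depends on the chosen representation of s.
  Symmetry makes the norms of the iterates log-convex, which removes K; this is why self-adjoint
  maps are treated first. The multiplier is set to 0 on the vectors killed by all commutators, which
  form the orthogonal complement of the closed span of the commutator ranges.\<close>

lemma cinner_add_right: "cinner x (y + z) = cinner x y + cinner x z"
  by (metis cinner_add_left cinner_commute complex_cnj_add)

lemma cinner_scaleC_right: "cinner x (c *\<^sub>C y) = cnj c * cinner x y"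
  by (metis cinner_commute cinner_scaleC_left complex_cnj_mult)

lemma scaleC_one [simp]: "1 *\<^sub>C x = x"
  by (metis of_real_1 scaleR_one scaleR_scaleC)

lemma scaleC_minus_one: "(-1) *\<^sub>C x = - x"
  by (metis of_real_1 of_real_minus scaleR_minus1_left scaleR_scaleC)

lemma cinner_minus_left: "cinner (- x) y = - cinner x y"
  by (metis cinner_scaleC_left mult_minus1 scaleC_minus_one)

lemma cinner_minus_right: "cinner x (- y) = - cinner x y"
  by (metis cinner_commute cinner_minus_left complex_cnj_minus)

lemma cinner_diff_left: "cinner (x - y) z = cinner x z - cinner y z"
  by (metis add_uminus_conv_diff cinner_add_left cinner_minus_left)

lemma cinner_diff_right: "cinner x (y - z) = cinner x y - cinner x z"
  by (metis add_uminus_conv_diff cinner_add_right cinner_minus_right)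

lemma cinner_zero_left [simp]: "cinner 0 y = 0"
  using cinner_diff_left[of 0 0] by simp

lemma cinner_zero_right [simp]: "cinner x 0 = 0"
  using cinner_diff_right[of x 0 0] by simp

lemma cinner_sum_left: "cinner (sum f S) y = (\<Sum>i\<in>S. cinner (f i) y)"
  by (induction S rule: infinite_finite_induct) (simp_all add: cinner_add_left)

lemma cinner_sum_right: "cinner x (sum f S) = (\<Sum>i\<in>S. cinner x (f i))"
  by (induction S rule: infinite_finite_induct) (simp_all add: cinner_add_right)

lemma cinner_scaleR_left: "cinner (r *\<^sub>R x) y = of_real r * cinner x y"
  by (simp add: scaleR_scaleC cinner_scaleC_left)

lemma cinner_scaleR_right: "cinner x (r *\<^sub>R y) = of_real r * cinner x y"
  by (simp add: scaleR_scaleC cinner_scaleC_right)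

lemma scaleC_diff_right: "c *\<^sub>C (x - y) = c *\<^sub>C x - c *\<^sub>C (y :: 'a::complex_hilbert_space)"
  using linear_diff[OF bounded_linear.linear[OF bounded_linear_scaleC]] .

lemma scaleC_zero_right [simp]: "c *\<^sub>C 0 = (0 :: 'a::complex_hilbert_space)"
  using scaleC_diff_right[of c 0 0] by simp

lemma scaleC_sum_right:
  "c *\<^sub>C sum f S = (\<Sum>i\<in>S. c *\<^sub>C (f i :: 'a::complex_hilbert_space))"
  by (induction S rule: infinite_finite_induct) (simp_all add: scaleC_add_right)

lemma Re_cinner_self: "Re (cinner x x) = (norm x)\<^sup>2"
  by (simp add: cinner_self)

lemma cinner_self_eq_0 [simp]: "cinner x x = 0 \<longleftrightarrow> x = 0"
  by (simp add: cinner_self)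

lemma norm_add_squared:
  "(norm (x + y))\<^sup>2 = (norm x)\<^sup>2 + (norm y)\<^sup>2 + 2 * Re (cinner x y)"
proof -
  have "Re (cinner y x) = Re (cinner x y)"
    by (subst cinner_commute) simp
  then show ?thesis
    unfolding Re_cinner_self[symmetric] by (simp add: cinner_add_left cinner_add_right)
qed

lemma norm_diff_squared:
  "(norm (x - y))\<^sup>2 = (norm x)\<^sup>2 + (norm y)\<^sup>2 - 2 * Re (cinner x y)"
  using norm_add_squared[of x "- y"] by (simp add: cinner_minus_right)

lemma Re_cinner_le: "Re (cinner x y) \<le> norm x * norm y"
proof (cases "x = 0 \<or> y = 0")
  case False
  let ?x = "norm y *\<^sub>R x" and ?y = "norm x *\<^sub>R y"
  have "0 \<le> (norm (?x - ?y))\<^sup>2" by simp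
  also have "\<dots> = 2 * (norm x * norm y) * (norm x * norm y - Re (cinner x y))"
    by (simp only: norm_diff_squared cinner_scaleR_left cinner_scaleR_right)
      (simp add: power2_eq_square algebra_simps)
  finally show ?thesis
    using False by (auto simp: zero_le_mult_iff mult_le_0_iff)
qed auto

lemma norm_cinner_le: "cmod (cinner x y) \<le> norm x * norm y"
proof (cases "cinner x y = 0")
  case False
  define c where "c = cnj (sgn (cinner x y))"
  have "cnj z * z / of_real (cmod z) = of_real (cmod z)" for z :: complex
    by (cases "z = 0") (simp_all add: complex_norm_square[symmetric] power2_eq_square mult.commute[of "cnj z"])
  then have "c * cinner x y = of_real (cmod (cinner x y))"
    by (simp add: c_def sgn_eq)
  then have "cmod (cinner x y) = Re (c * cinner x y)"
    by simp
  also have "\<dots> \<le> norm (c *\<^sub>C x) * norm y"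
    by (metis Re_cinner_le cinner_scaleC_left)
  also have "norm (c *\<^sub>C x) = norm x"
    using False by (simp add: norm_scaleC c_def norm_sgn)
  finally show ?thesis .
qed auto

lemma bounded_bilinear_cinner: "bounded_bilinear cinner"
proof
  show "\<exists>K. \<forall>x y. norm (cinner x y) \<le> norm x * norm y * K"
    by (rule exI[of _ 1]) (simp add: norm_cinner_le)
qed (simp_all add: cinner_add_left cinner_add_right cinner_scaleR_left cinner_scaleR_right
    scaleR_conv_of_real)

text \<open>A minimising sequence is Cauchy by the parallelogram law.\<close>

lemma orthogonal_projection_exists:
  fixes S :: "'a::complex_hilbert_space set"
  assumes S: "closed S" "subspace S" "\<And>c x. x \<in> S \<Longrightarrow> c *\<^sub>C x \<in> S"
  obtains p where "p \<in> S" "\<And>s. s \<in> S \<Longrightarrow> cinner (x - p) s = 0"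
proof -
  define d where "d = infdist x S"
  have ne: "S \<noteq> {}" using S(2) subspace_0 by blast
  have dle: "d \<le> norm (x - s)" if "s \<in> S" for s
    using infdist_le[OF that, of x] by (simp add: d_def dist_norm)
  have d0: "d \<ge> 0" by (simp add: d_def infdist_nonneg)
  have "\<exists>s\<in>S. norm (x - s) < d + inverse (Suc n)" for n
  proof (rule ccontr)
    assume "\<not> ?thesis"
    then have "d + inverse (Suc n) \<le> dist x s" if "s \<in> S" for s
      using that by (force simp: dist_norm)
    then have "d + inverse (Suc n) \<le> infdist x S"
      using ne by (simp add: infdist_def cINF_greatest)
    then show False by (simp add: d_def)
  qed
  then obtain s where s: "\<And>n. s n \<in> S" "\<And>n. norm (x - s n) < d + inverse (Suc n)"
    by metis
  have par: "(norm (a - b))\<^sup>2 \<le> 2 * (norm (x - a))\<^sup>2 + 2 * (norm (x - b))\<^sup>2 - 4 * d\<^sup>2"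
    if "a \<in> S" "b \<in> S" for a b
  proof -
    have "(1/2) *\<^sub>R (a + b) \<in> S"
      using that S(2) by (simp add: subspace_add subspace_scale)
    from dle[OF this] d0 have "d\<^sup>2 \<le> (norm (x - (1/2) *\<^sub>R (a + b)))\<^sup>2"
      by (simp add: power_mono)
    moreover have "(norm ((x - a) + (x - b)))\<^sup>2 = 4 * (norm (x - (1/2) *\<^sub>R (a + b)))\<^sup>2"
    proof -
      have "(x - a) + (x - b) = 2 *\<^sub>R (x - (1/2) *\<^sub>R (a + b))"
        by (simp add: algebra_simps scaleR_2)
      then show ?thesis by (simp add: power_mult_distrib)
    qed
    moreover have "(norm ((x - a) - (x - b)))\<^sup>2 = (norm (a - b))\<^sup>2"
      by (simp add: norm_minus_commute)
    ultimately show ?thesis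
      using norm_add_squared[of "x - a" "x - b"] norm_diff_squared[of "x - a" "x - b"] by linarith
  qed
  have lim: "(\<lambda>n. (d + inverse (real (Suc n)))\<^sup>2) \<longlonglongrightarrow> d\<^sup>2"
  proof -
    have "(\<lambda>n. (d + inverse (real (Suc n)))\<^sup>2) \<longlonglongrightarrow> (d + 0)\<^sup>2"
      by (intro tendsto_intros LIMSEQ_inverse_real_of_nat)
    then show ?thesis by simp
  qed
  have "Cauchy s"
  proof (rule metric_CauchyI)
    fix e :: real assume "e > 0"
    then have "eventually (\<lambda>n. (d + inverse (real (Suc n)))\<^sup>2 < d\<^sup>2 + e\<^sup>2 / 4) sequentially"
      using lim by (intro order_tendstoD) auto
    then obtain N where N: "\<And>n. n \<ge> N \<Longrightarrow> (d + inverse (real (Suc n)))\<^sup>2 < d\<^sup>2 + e\<^sup>2 / 4"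
      by (auto simp: eventually_sequentially)
    have *: "(norm (x - s n))\<^sup>2 < d\<^sup>2 + e\<^sup>2 / 4" if "n \<ge> N" for n
      using N[OF that] power_mono[OF less_imp_le[OF s(2)[of n]], of 2] by force
    have "dist (s m) (s n) < e" if "m \<ge> N" "n \<ge> N" for m n
    proof -
      have "(norm (s m - s n))\<^sup>2 < e\<^sup>2"
        using par[OF s(1)[of m] s(1)[of n]] *[OF that(1)] *[OF that(2)] by linarith
      then show ?thesis
        using \<open>e > 0\<close> by (simp add: dist_norm power2_less_imp_less)
    qed
    then show "\<exists>M. \<forall>m\<ge>M. \<forall>n\<ge>M. dist (s m) (s n) < e" by blast
  qed
  then obtain p where p: "s \<longlonglongrightarrow> p"
    using Cauchy_convergent_iff convergent_def by blast
  have pS: "p \<in> S"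
    using closed_sequentially[OF S(1)] s(1) p by blast
  have "norm (x - p) \<le> d"
  proof (rule LIMSEQ_le)
    show "(\<lambda>n. norm (x - s n)) \<longlonglongrightarrow> norm (x - p)"
      by (intro tendsto_intros p)
    show "(\<lambda>n. d + inverse (real (Suc n))) \<longlonglongrightarrow> d"
      using tendsto_add[OF tendsto_const LIMSEQ_inverse_real_of_nat, of d] by simp
    show "\<exists>N. \<forall>n\<ge>N. norm (x - s n) \<le> d + inverse (real (Suc n))"
      using s(2) less_imp_le by blast
  qed
  then have min: "norm (x - p) \<le> norm (x - s)" if "s \<in> S" for s
    using dle[OF that] by simp
  have "cinner (x - p) s = 0" if "s \<in> S" for s
  proof (cases "s = 0")
    case False
    \<comment> \<open>\<open>c *\<^sub>C s\<close> is the projection of \<open>x - p\<close> onto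
      the line of \<open>s\<close>; unless \<open>c = 0\<close>, moving \<open>p\<close> by it would
      bring it closer to \<open>x\<close> than the minimum.\<close>
    define c where "c = cinner (x - p) s / of_real ((norm s)\<^sup>2)"
    have "p + c *\<^sub>C s \<in> S"
      using pS that S by (simp add: subspace_add)
    from min[OF this] have "(norm (x - p))\<^sup>2 \<le> (norm ((x - p) - c *\<^sub>C s))\<^sup>2"
      by (simp add: power_mono diff_diff_eq)
    moreover have "Re (cinner (x - p) (c *\<^sub>C s)) = (cmod (cinner (x - p) s))\<^sup>2 / (norm s)\<^sup>2"
    proof -
      have "cinner (x - p) (c *\<^sub>C s)
        = cinner (x - p) s * cnj (cinner (x - p) s) / of_real ((norm s)\<^sup>2)"
        by (simp add: cinner_scaleC_right c_def)
      also have "\<dots> = of_real ((cmod (cinner (x - p) s))\<^sup>2 / (norm s)\<^sup>2)"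
        by (simp only: complex_norm_square [symmetric] of_real_divide)
      finally show ?thesis by simp
    qed
    moreover have "(norm (c *\<^sub>C s))\<^sup>2 = (cmod (cinner (x - p) s))\<^sup>2 / (norm s)\<^sup>2"
      using False by (simp add: norm_scaleC c_def norm_divide norm_mult power2_eq_square)
    ultimately have "(cmod (cinner (x - p) s))\<^sup>2 / (norm s)\<^sup>2 \<le> 0"
      using norm_diff_squared[of "x - p" "c *\<^sub>C s"] by linarith
    then show ?thesis
      using False by (simp add: divide_le_0_iff)
  qed simp
  with pS that show thesis by blast
qed

text \<open>Applied to \<open>a m = \<parallel>T\<^sup>m h\<parallel>\<close> for a symmetric or normal operator \<open>T\<close>, this bounds \<open>T\<close> by its
  spectral radius.\<close>

lemma log_convex_growth:
  fixes a :: "nat \<Rightarrow> real"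
  assumes nonneg: "\<And>m. a m \<ge> 0"
    and convex: "\<And>m. (a (Suc m))\<^sup>2 \<le> a m * a (Suc (Suc m))"
    and growth: "\<And>m. a m \<le> K * C ^ m"
    and C: "C > 0"
  shows "a 1 \<le> C * a 0"
proof (rule ccontr)
  assume less: "\<not> ?thesis"
  have "a 0 > 0"
  proof (rule ccontr)
    assume "\<not> a 0 > 0"
    then have "a 0 = 0" using nonneg[of 0] by simp
    with convex[of 0] less show False by simp
  qed
  define r where "r = a 1 / a 0"
  have r: "r > C" using less \<open>a 0 > 0\<close> by (simp add: r_def field_simps)
  \<comment> \<open>Convexity makes the ratios of consecutive terms nondecreasing. The first ratio
    exceeds \<open>C\<close>, so \<open>a\<close> outgrows every multiple of
    \<open>C ^ m\<close>.\<close>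
  have step: "a m > 0 \<and> a (Suc m) \<ge> r * a m" for m
  proof (induction m)
    case 0
    then show ?case using \<open>a 0 > 0\<close> by (simp add: r_def)
  next
    case (Suc m)
    have pos: "a (Suc m) > 0"
      using Suc r C by (smt (verit) mult_pos_pos)
    have "r * a m * a (Suc m) \<le> (a (Suc m))\<^sup>2"
      using Suc pos by (simp add: power2_eq_square)
    also have "\<dots> \<le> a m * a (Suc (Suc m))" by (rule convex)
    finally have "a m * (r * a (Suc m)) \<le> a m * a (Suc (Suc m))"
      by (simp add: mult_ac)
    then show ?case using Suc pos by (simp only: mult_le_cancel_left_pos)
  qed
  have ge: "a m \<ge> r ^ m * a 0" for m
  proof (induction m)
    case (Suc m)
    have "r ^ Suc m * a 0 \<le> r * a m"
      using Suc r C by (simp add: mult.assoc)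
    also have "\<dots> \<le> a (Suc m)" using step by blast
    finally show ?case .
  qed simp
  have "(r / C) ^ m \<le> K / a 0" for m
    using order.trans[OF ge growth, of m] \<open>a 0 > 0\<close> C by (simp add: field_simps power_divide)
  moreover have "r / C > 1" using r C by simp
  ultimately show False
    by (meson linorder_not_less real_arch_pow)
qed

section \<open>Algebra and adjoints in a von Neumann algebra\<close>

lemmas blinfun_simps = blinfun.bilinear_simps

lemma commutator_apply: "commutator A B x = A (B x) - B (A x)"
  by (simp add: commutator_def blinfun_simps)

lemma commutator_add_left: "commutator (A + B) C = commutator A C + commutator B C"
  by (rule blinfun_eqI) (simp add: commutator_apply blinfun_simps)

lemma commutator_add_right: "commutator A (B + C) = commutator A B + commutator A C"
  by (rule blinfun_eqI) (simp add: commutator_apply blinfun_simps)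

lemma commutator_diff_left: "commutator (A - B) C = commutator A C - commutator B C"
  by (rule blinfun_eqI) (simp add: commutator_apply blinfun_simps)

lemma commutator_diff_right: "commutator A (B - C) = commutator A B - commutator A C"
  by (rule blinfun_eqI) (simp add: commutator_apply blinfun_simps)

lemma commutator_scaleR_left: "commutator (r *\<^sub>R A) B = r *\<^sub>R commutator A B"
  by (rule blinfun_eqI) (simp add: commutator_apply blinfun_simps scaleR_diff_right)

lemma commutator_scaleR_right: "commutator A (r *\<^sub>R B) = r *\<^sub>R commutator A B"
  by (rule blinfun_eqI) (simp add: commutator_apply blinfun_simps scaleR_diff_right)

lemma commutator_swap: "commutator B A = - commutator A B"
  by (simp add: commutator_def)

lemma commutator_self [simp]: "commutator A A = 0"
  by (simp add: commutator_def)

lemma commutator_zero_left [simp]: "commutator 0 A = 0"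
  by (rule blinfun_eqI) (simp add: commutator_apply)

lemma norm_commutator: "norm (commutator A B) \<le> 2 * norm A * norm B"
  unfolding commutator_def
  using norm_triangle_ineq4[of "A o\<^sub>L B" "B o\<^sub>L A"] norm_blinfun_compose[of A B]
    norm_blinfun_compose[of B A] by (simp add: mult.commute[of "norm B"])

lemma bounded_bilinear_commutator: "bounded_bilinear commutator"
  by standard (auto simp: commutator_add_left commutator_add_right commutator_scaleR_left
      commutator_scaleR_right intro!: exI[of _ 2] norm_commutator
      order.trans[OF norm_commutator])

lemma is_adjoint_unique:
  assumes "is_adjoint A B" "is_adjoint A C"
  shows "B = C"
proof (rule blinfun_eqI)
  fix y
  have "cinner (B y - C y) (B y - C y) = 0"
    using assms unfolding is_adjoint_def by (metis cinner_diff_right diff_self)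
  then show "B y = C y" by simp
qed

text \<open>Meaningful only where an adjoint exists; elements of \<open>U\<close> have one in
  \<open>U\<close> by the definition of a von Neumann algebra.\<close>

definition adj :: "('h::complex_hilbert_space \<Rightarrow>\<^sub>L 'h) \<Rightarrow> ('h \<Rightarrow>\<^sub>L 'h)" where
  "adj A = (THE B. is_adjoint A B)"

lemma adjI: "is_adjoint A B \<Longrightarrow> adj A = B"
  unfolding adj_def using is_adjoint_unique by blast

locale von_neumann =
  fixes U :: "('h::complex_hilbert_space \<Rightarrow>\<^sub>L 'h) set"
  assumes vn: "von_neumann_algebra U"
begin

lemma scaleC_apply: "A \<in> U \<Longrightarrow> A (c *\<^sub>C x) = c *\<^sub>C A x"
  using vn unfolding von_neumann_algebra_def bounded_operators_def by blast

lemma id_in [simp]: "id_blinfun \<in> U"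
  and add_in [simp]: "A \<in> U \<Longrightarrow> B \<in> U \<Longrightarrow> A + B \<in> U"
  and scaleC_in [simp]: "A \<in> U \<Longrightarrow> scaleC_op c A \<in> U"
  and compose_in [simp]: "A \<in> U \<Longrightarrow> B \<in> U \<Longrightarrow> A o\<^sub>L B \<in> U"
  using vn unfolding von_neumann_algebra_def by blast+

lemma scaleR_in [simp]:
  assumes "A \<in> U"
  shows "r *\<^sub>R A \<in> U"
proof -
  have "r *\<^sub>R A = scaleC_op (of_real r) A"
    by (rule blinfun_eqI) (simp add: blinfun_simps scaleR_scaleC)
  then show ?thesis using assms by simp
qed

lemma uminus_in [simp]: "A \<in> U \<Longrightarrow> - A \<in> U"
  using scaleR_in[of A "-1"] by simp

lemma diff_in [simp]: "A \<in> U \<Longrightarrow> B \<in> U \<Longrightarrow> A - B \<in> U"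
  using add_in[of A "- B"] by simp

lemma zero_in [simp]: "0 \<in> U"
  using scaleR_in[OF id_in, of 0] by simp

lemma sum_in: "(\<And>i. i \<in> I \<Longrightarrow> A i \<in> U) \<Longrightarrow> sum A I \<in> U"
  by (induction I rule: infinite_finite_induct) simp_all

lemma commutator_in [simp]: "A \<in> U \<Longrightarrow> B \<in> U \<Longrightarrow> commutator A B \<in> U"
  by (simp add: commutator_def)

lemma adj_exists:
  assumes "A \<in> U"
  shows "adj A \<in> U \<and> is_adjoint A (adj A)"
proof -
  obtain B where "B \<in> U" "is_adjoint A B"
    using vn assms unfolding von_neumann_algebra_def by blast
  then show ?thesis using adjI by metis
qed

lemma adj_in [simp]: "A \<in> U \<Longrightarrow> adj A \<in> U"
  using adj_exists by blast

lemma cinner_adj_right: "A \<in> U \<Longrightarrow> cinner x (adj A y) = cinner (A x) y"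
  using adj_exists unfolding is_adjoint_def by metis

lemma cinner_adj_left: "A \<in> U \<Longrightarrow> cinner (adj A x) y = cinner x (A y)"
  by (metis cinner_adj_right cinner_commute)

lemma adj_eqI:
  fixes A B :: "'h \<Rightarrow>\<^sub>L 'h"
  assumes "\<And>x y. cinner (A x) y = cinner x (B y)"
  shows "adj A = B"
  using assms by (intro adjI) (simp add: is_adjoint_def)

lemma adj_adj [simp]: "A \<in> U \<Longrightarrow> adj (adj A) = A"
  by (rule adj_eqI) (simp add: cinner_adj_left)

lemma adj_add: "A \<in> U \<Longrightarrow> B \<in> U \<Longrightarrow> adj (A + B) = adj A + adj B"
  by (rule adj_eqI) (simp add: blinfun_simps cinner_add_left cinner_add_right cinner_adj_right)

lemma adj_diff: "A \<in> U \<Longrightarrow> B \<in> U \<Longrightarrow> adj (A - B) = adj A - adj B"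
  by (rule adj_eqI) (simp add: blinfun_simps cinner_diff_left cinner_diff_right cinner_adj_right)

lemma adj_compose: "A \<in> U \<Longrightarrow> B \<in> U \<Longrightarrow> adj (A o\<^sub>L B) = adj B o\<^sub>L adj A"
  by (rule adj_eqI) (simp add: cinner_adj_right)

lemma adj_commutator:
  "A \<in> U \<Longrightarrow> B \<in> U \<Longrightarrow> adj (commutator A B) = commutator (adj B) (adj A)"
  by (simp add: commutator_def adj_diff adj_compose)

lemma adj_scaleC: "A \<in> U \<Longrightarrow> adj (scaleC_op c A) = scaleC_op (cnj c) (adj A)"
  by (rule adj_eqI) (simp add: cinner_scaleC_left cinner_scaleC_right cinner_adj_right)

text \<open>Pointwise approximation on finite sets suffices because a basic weak neighbourhood of
  \<open>T\<close> constrains finitely many pairs \<open>(x, y)\<close>, and Cauchy-Schwarz bounds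
  each matrix coefficient by \<open>norm (A x - T x) * norm y\<close>.\<close>

lemma weakly_closed:
  assumes T: "T \<in> bounded_operators"
    and approx: "\<And>I e. finite I \<Longrightarrow> e > 0 \<Longrightarrow> \<exists>A\<in>U. \<forall>x\<in>I. norm (A x - T x) < e"
  shows "T \<in> U"
proof (rule ccontr)
  let ?\<Phi> = "\<lambda>A (x, y). cinner (blinfun_apply A x) y"
  assume "T \<notin> U"
  have "openin weak_operator_topology (topspace weak_operator_topology - U)"
    using vn unfolding von_neumann_algebra_def closedin_def by blast
  then obtain V :: "('h \<times> 'h \<Rightarrow> complex) set" where
    V: "open V" "topspace weak_operator_topology - U = ?\<Phi> -` V \<inter> bounded_operators"
    unfolding weak_operator_topology_def openin_pullback_topology open_openin [symmetric] by blast
  have "topspace weak_operator_topology = (bounded_operators :: ('h \<Rightarrow>\<^sub>L 'h) set)"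
    unfolding weak_operator_topology_def topspace_pullback_topology by simp
  then have TV: "?\<Phi> T \<in> V" and U: "\<And>A. A \<in> U \<Longrightarrow> ?\<Phi> A \<notin> V"
    using V(2) T \<open>T \<notin> U\<close> vn unfolding von_neumann_algebra_def by blast+
  obtain X where X: "?\<Phi> T \<in> (\<Pi>\<^sub>E i\<in>UNIV. X i)" "\<And>i. open (X i)" "finite {i. X i \<noteq> UNIV}"
      "(\<Pi>\<^sub>E i\<in>UNIV. X i) \<subseteq> V"
    using product_topology_open_contains_basis[of "\<lambda>_. euclidean" UNIV V "?\<Phi> T"] TV V(1)
    unfolding euclidean_product_topology open_openin [symmetric] topspace_euclidean by blast
  define P where "P = {i. X i \<noteq> UNIV}"
  have "\<exists>e>0. \<forall>z. dist z (?\<Phi> T i) < e \<longrightarrow> z \<in> X i" for i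
  proof -
    have "?\<Phi> T i \<in> X i" using X(1) by (rule PiE_mem) simp
    with X(2)[of i] show ?thesis unfolding open_dist by blast
  qed
  then obtain d where d: "\<And>i. d i > 0" "\<And>i z. dist z (?\<Phi> T i) < d i \<Longrightarrow> z \<in> X i"
    by metis
  \<comment> \<open>The entry 1 keeps \<open>Min\<close> meaningful for empty \<open>P\<close>, and
    the \<open>+ 1\<close> in the denominator allows \<open>y = 0\<close>.\<close>
  define e where "e = Min (insert 1 ((\<lambda>i. d i / (norm (snd i) + 1)) ` P))"
  have fin: "finite P" using X(3) by (simp add: P_def)
  have pos: "norm y + 1 > 0" for y :: 'h
    by (simp add: add_nonneg_pos)
  have "e > 0"
    unfolding e_def using fin d(1) pos by (subst Min_gr_iff) auto
  have ele: "e \<le> d i / (norm (snd i) + 1)" if "i \<in> P" for i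
    unfolding e_def using fin that by (intro Min_le) auto
  obtain A where A: "A \<in> U" "\<forall>x\<in>fst ` P. norm (A x - T x) < e"
    using approx[OF finite_imageI[OF fin] \<open>e > 0\<close>] by blast
  have "?\<Phi> A i \<in> X i" for i
  proof (cases "i \<in> P")
    case True
    obtain x y where i: "i = (x, y)" by fastforce
    have "norm (A x - T x) < e" using A(2) True i by force
    then have *: "norm (A x - T x) * (norm y + 1) < d i"
      using ele[OF True] pos[of y] i
      by (smt (verit) mult_less_cancel_right_pos pos_le_divide_eq snd_conv)
    have "dist (cinner (A x) y) (cinner (T x) y) \<le> norm (A x - T x) * norm y"
      by (simp add: dist_norm norm_cinner_le flip: cinner_diff_left)
    also have "\<dots> \<le> norm (A x - T x) * (norm y + 1)"
      by (simp add: mult_left_mono)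
    finally show ?thesis using * d(2)[of "cinner (A x) y" i] i by simp
  qed (simp add: P_def)
  then have "?\<Phi> A \<in> V" using X(4) by (auto simp: PiE_iff)
  with U A(1) show False by blast
qed

lemma norm_closed: "closed U"
proof (subst closed_sequential_limits, intro allI impI)
  fix S T assume ST: "(\<forall>n. S n \<in> U) \<and> S \<longlonglongrightarrow> T"
  then have lim: "(\<lambda>n. S n x) \<longlonglongrightarrow> T x" for x
    using blinfun.tendsto[OF _ tendsto_const] by blast
  show "T \<in> U"
  proof (rule weakly_closed)
    have "T (c *\<^sub>C x) = c *\<^sub>C T x" for c x
    proof (rule LIMSEQ_unique)
      show "(\<lambda>n. S n (c *\<^sub>C x)) \<longlonglongrightarrow> T (c *\<^sub>C x)" by (rule lim)
      show "(\<lambda>n. S n (c *\<^sub>C x)) \<longlonglongrightarrow> c *\<^sub>C T x"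
        using bounded_linear.tendsto[OF bounded_linear_scaleC lim] ST
        by (simp add: scaleC_apply)
    qed
    then show "T \<in> bounded_operators" by (simp add: bounded_operators_def)
    fix I :: "'h set" and e :: real assume "finite I" "e > 0"
    then have "eventually (\<lambda>n. \<forall>x\<in>I. norm (S n x - T x) < e) sequentially"
      using lim by (intro eventually_ball_finite) (auto simp: tendsto_iff dist_norm)
    then show "\<exists>A\<in>U. \<forall>x\<in>I. norm (A x - T x) < e"
      using ST eventually_happens'[OF sequentially_bot] by blast
  qed
qed

section \<open>The center of a von Neumann algebra\<close>

lemma center_iff: "Z \<in> center U \<longleftrightarrow> Z \<in> U \<and> (\<forall>A\<in>U. commutator Z A = 0)"
  by (auto simp: center_def commutator_def)

lemma center_commute: "Z \<in> center U \<Longrightarrow> A \<in> U \<Longrightarrow> Z (A x) = A (Z x)"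
  unfolding center_def by (metis (mono_tags, lifting) blinfun_apply_blinfun_compose mem_Collect_eq)

lemma center_centralizes: "Z \<in> center U \<Longrightarrow> A \<in> U \<Longrightarrow> commutator Z A = 0"
  by (simp add: center_iff)

lemma zero_center [simp]: "0 \<in> center U"
  by (simp add: center_iff)

lemma center_add: "Y \<in> center U \<Longrightarrow> Z \<in> center U \<Longrightarrow> Y + Z \<in> center U"
  by (auto simp: center_iff commutator_add_left)

lemma center_scaleC:
  assumes "Z \<in> center U"
  shows "scaleC_op c Z \<in> center U"
proof -
  have "commutator (scaleC_op c Z) A = scaleC_op c (commutator Z A)" if "A \<in> U" for A
    using that by (intro blinfun_eqI) (simp add: commutator_apply scaleC_apply scaleC_diff_right)
  moreover have "scaleC_op c (0 :: 'h \<Rightarrow>\<^sub>L 'h) = 0"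
    by (rule blinfun_eqI) simp
  ultimately show ?thesis
    using assms by (simp add: center_iff)
qed

section \<open>Central commutators vanish\<close>

lemma norm_power_apply_le: "norm ((blinfun_apply C ^^ m) h) \<le> norm C ^ m * norm h"
  for C :: "'h \<Rightarrow>\<^sub>L 'h"
proof (induction m)
  case (Suc m)
  have "norm (C ((blinfun_apply C ^^ m) h)) \<le> norm C * (norm C ^ m * norm h)"
    using Suc by (meson mult_left_mono norm_blinfun norm_ge_zero order_trans)
  then show ?case by (simp add: mult.assoc)
qed simp

text \<open>Since \<open>[D, X\<^sup>l\<^sup>+\<^sup>1] = (l + 1) C X\<^sup>l\<close> for a central \<open>C = [D, X]\<close>, the norms of \<open>C\<^sup>k X\<^sup>l\<close> decrease
  factorially in \<open>k\<close>. So \<open>C\<close> is quasinilpotent; being normal, it vanishes.\<close>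

lemma commutator_compose_power:
  assumes DX: "D \<in> U" "X \<in> U" "commutator D X \<in> center U"
  shows "D ((blinfun_apply X ^^ Suc l) h) - (blinfun_apply X ^^ Suc l) (D h)
    = real (Suc l) *\<^sub>R commutator D X ((blinfun_apply X ^^ l) h)"
proof (induction l)
  case 0
  then show ?case by (simp add: commutator_apply)
next
  case (Suc l)
  let ?C = "commutator D X" and ?v = "(blinfun_apply X ^^ Suc l) h"
  have "D (X ?v) = ?C ?v + X (D ?v)"
    by (simp add: commutator_apply)
  also have "X (D ?v) = X ((blinfun_apply X ^^ Suc l) (D h)
      + real (Suc l) *\<^sub>R ?C ((blinfun_apply X ^^ l) h))"
    using Suc by (metis add.commute diff_add_cancel)
  also have "\<dots> = (blinfun_apply X ^^ Suc (Suc l)) (D h) + real (Suc l) *\<^sub>R ?C ?v"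
    using center_commute[OF DX(3,2)] by (simp add: blinfun_simps)
  finally show ?case
    by (simp add: algebra_simps scaleR_2)
qed

lemma central_commutator_zero:
  assumes DX: "D \<in> U" "X \<in> U" "commutator D X \<in> center U"
  shows "commutator D X = 0"
proof -
  define C where "C = commutator D X"
  have C: "C \<in> U" "\<And>A x. A \<in> U \<Longrightarrow> C (A x) = A (C x)"
    using DX center_commute by (auto simp: C_def)
  have Cpow: "(blinfun_apply C ^^ k) (A x) = A ((blinfun_apply C ^^ k) x)" if "A \<in> U" for A k x
    by (induction k) (simp_all add: C(2)[OF that])
  define b where "b = 2 * norm D"
  \<comment> \<open>Induction on \<open>k\<close> with \<open>l\<close> arbitrary: one factor
    \<open>C\<close> is traded for one more \<open>X\<close> and a bracket with \<open>D\<close>.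
    The two terms of that bracket cause the factor 2 in \<open>b\<close>.\<close>
  have factorial: "fact (k + l) * norm ((blinfun_apply C ^^ k) ((blinfun_apply X ^^ l) h))
      \<le> fact l * (b ^ k * norm X ^ (k + l) * norm h)" for k l h
  proof (induction k arbitrary: l h)
    case 0
    show ?case using norm_power_apply_le[where C = X and m = l and h = h] by (simp add: mult_left_mono)
  next
    case (Suc k)
    let ?v = "\<lambda>l h. (blinfun_apply C ^^ k) ((blinfun_apply X ^^ l) h)"
    have "real (Suc l) *\<^sub>R (blinfun_apply C ^^ Suc k) ((blinfun_apply X ^^ l) h)
        = D (?v (Suc l) h) - ?v (Suc l) (D h)"
    proof -
      have lin: "(blinfun_apply C ^^ k) (x - y) = (blinfun_apply C ^^ k) x - (blinfun_apply C ^^ k) y"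
        "(blinfun_apply C ^^ k) (r *\<^sub>R x) = r *\<^sub>R (blinfun_apply C ^^ k) x" for x y r
        by (induction k) (simp_all add: blinfun_simps)
      have "D (?v (Suc l) h) - ?v (Suc l) (D h) = (blinfun_apply C ^^ k)
          (D ((blinfun_apply X ^^ Suc l) h) - (blinfun_apply X ^^ Suc l) (D h))"
        by (simp only: lin Cpow[OF DX(1)])
      also have "\<dots> = real (Suc l) *\<^sub>R (blinfun_apply C ^^ k) (C ((blinfun_apply X ^^ l) h))"
        by (simp only: commutator_compose_power[OF DX] lin flip: C_def)
      finally show ?thesis by (simp add: funpow_swap1)
    qed
    then have "real (Suc l) * norm ((blinfun_apply C ^^ Suc k) ((blinfun_apply X ^^ l) h))
        = norm (D (?v (Suc l) h) - ?v (Suc l) (D h))"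
      by (metis abs_of_nat norm_scaleR)
    also have "\<dots> \<le> norm D * norm (?v (Suc l) h) + norm (?v (Suc l) (D h))"
      by (meson add_right_mono norm_blinfun norm_triangle_ineq4 order_trans)
    finally have "fact (k + Suc l) *
        (real (Suc l) * norm ((blinfun_apply C ^^ Suc k) ((blinfun_apply X ^^ l) h)))
      \<le> norm D * (fact (k + Suc l) * norm (?v (Suc l) h)) + fact (k + Suc l) * norm (?v (Suc l) (D h))"
      by (smt (verit) distrib_left fact_ge_zero mult.left_commute mult_left_mono)
    also have "\<dots> \<le> norm D * (fact (Suc l) * (b ^ k * norm X ^ (k + Suc l) * norm h))
        + fact (Suc l) * (b ^ k * norm X ^ (k + Suc l) * (norm D * norm h))"
    proof (rule add_mono)
      show "norm D * (fact (k + Suc l) * norm (?v (Suc l) h))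
          \<le> norm D * (fact (Suc l) * (b ^ k * norm X ^ (k + Suc l) * norm h))"
        using Suc[of "Suc l" h] by (rule mult_left_mono) simp
      have "fact (k + Suc l) * norm (?v (Suc l) (D h))
          \<le> fact (Suc l) * (b ^ k * norm X ^ (k + Suc l) * norm (D h))"
        by (rule Suc)
      also have "\<dots> \<le> fact (Suc l) * (b ^ k * norm X ^ (k + Suc l) * (norm D * norm h))"
        by (intro mult_left_mono norm_blinfun) (simp_all add: b_def)
      finally show "fact (k + Suc l) * norm (?v (Suc l) (D h))
          \<le> fact (Suc l) * (b ^ k * norm X ^ (k + Suc l) * (norm D * norm h))" .
    qed
    also have "\<dots> = real (Suc l) * (fact l * (b ^ Suc k * norm X ^ (Suc k + l) * norm h))"
      by (simp add: b_def algebra_simps)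
    finally have "real (Suc l) * (fact (Suc k + l)
          * norm ((blinfun_apply C ^^ Suc k) ((blinfun_apply X ^^ l) h)))
        \<le> real (Suc l) * (fact l * (b ^ Suc k * norm X ^ (Suc k + l) * norm h))"
      by (simp only: mult_ac add_Suc_right add_Suc)
    then show ?case
      by (subst (asm) mult_le_cancel_left_pos) auto
  qed
  have "C h = 0" for h
  proof -
    have le: "norm (C h) \<le> e * norm h" if "e > 0" for e
    proof -
      let ?a = "\<lambda>m. norm ((blinfun_apply C ^^ m) h)"
      \<comment> \<open>With this \<open>t\<close>, \<open>b * norm X = t * e\<close> and
        \<open>t ^ m / fact m \<le> exp t\<close>, so the growth rate is the arbitrary
        \<open>e\<close>, with constant \<open>exp t * norm h\<close>.\<close>
      define t where "t = b * norm X / e"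
      have t: "t \<ge> 0" using that by (simp add: t_def b_def)
      have "?a 1 \<le> e * ?a 0"
      proof (rule log_convex_growth[OF _ _ _ that])
        fix m
        let ?k = "(blinfun_apply C ^^ m) h"
        \<comment> \<open>Being central, \<open>C\<close> commutes with \<open>adj C\<close>, so it
          is normal; this gives the log-convexity.\<close>
        have "norm (adj C (C ?k)) = norm (C (C ?k))"
        proof -
          have "cinner (adj C (C ?k)) (adj C (C ?k)) = cinner (C (C ?k)) (C (C ?k))"
            using C(1) C(2)[OF adj_in[OF C(1)]] by (simp add: cinner_adj_right cinner_adj_left)
          then show ?thesis
            by (metis Re_cinner_self norm_ge_zero power2_eq_imp_eq)
        qed
        moreover have "(norm (C ?k))\<^sup>2 = Re (cinner (adj C (C ?k)) ?k)"
          using C(1) by (simp add: cinner_adj_left Re_cinner_self)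
        ultimately show "(?a (Suc m))\<^sup>2 \<le> ?a m * ?a (Suc (Suc m))"
          using Re_cinner_le[of "adj C (C ?k)" ?k] by (simp add: mult.commute)
        have "t ^ m / fact m \<le> exp t"
          using sum_le_suminf[OF summable_exp[of t], of "{m}"] t
          by (simp add: exp_def divide_inverse mult.commute)
        then have "t ^ m \<le> exp t * fact m" by (simp add: divide_simps)
        have "fact m * ?a m \<le> (b * norm X) ^ m * norm h"
          using factorial[of m 0 h] by (simp add: power_mult_distrib)
        also have "b * norm X = t * e" using that by (simp add: t_def)
        also have "(t * e) ^ m * norm h \<le> exp t * fact m * (e ^ m * norm h)"
          using mult_right_mono[OF \<open>t ^ m \<le> exp t * fact m\<close>, of "e ^ m * norm h"] that
          by (simp add: power_mult_distrib mult.assoc)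
        finally have "fact m * ?a m \<le> fact m * ((exp t * norm h) * e ^ m)"
          by (simp add: mult_ac)
        then show "?a m \<le> (exp t * norm h) * e ^ m"
          by (subst (asm) mult_le_cancel_left_pos) auto
      qed simp
      then show ?thesis by simp
    qed
    then have "norm (C h) \<le> e" if "e > 0" for e
    proof -
      have "norm (C h) \<le> e / (norm h + 1) * norm h"
        using that by (intro le) (simp add: add_nonneg_pos)
      also have "\<dots> \<le> e" using that by (simp add: divide_simps add_nonneg_pos)
      finally show ?thesis .
    qed
    then have "norm (C h) \<le> 0" by (rule field_le_epsilon[of _ 0, simplified])
    then show ?thesis by simp
  qed
  then show ?thesis
    unfolding C_def[symmetric] by (intro blinfun_eqI) simp
qed

text \<open>Each \<open>commutator D A\<close> is itself a central commutator, hence zero. Repeated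
  use strips the outer brackets of \<open>lie_poly\<close> one at a time.\<close>

lemma central_if_commutators_central:
  assumes "D \<in> U" "\<And>A. A \<in> U \<Longrightarrow> commutator D A \<in> center U"
  shows "D \<in> center U"
  using assms central_commutator_zero by (simp add: center_iff)

section \<open>Reduction to commuting maps\<close>

lemma lie_poly_in: "(\<And>i. i \<in> {1..n} \<Longrightarrow> A i \<in> U) \<Longrightarrow> lie_poly n A \<in> U"
  by (induction n A rule: lie_poly.induct) simp_all

lemma lie_poly_cong: "(\<And>i. i \<in> {1..n} \<Longrightarrow> A i = B i) \<Longrightarrow> lie_poly n A = lie_poly n B"
  by (induction n A rule: lie_poly.induct) simp_all

lemma lie_poly_add_first:
  "lie_poly n (A(1 := X + Y)) = lie_poly n (A(1 := X)) + lie_poly n (A(1 := Y))"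
  by (induction n A rule: lie_poly.induct) (simp_all add: commutator_add_left)

lemma lie_poly_zero_first: "lie_poly n (A(1 := 0)) = 0"
  by (induction n A rule: lie_poly.induct) simp_all

lemma lie_poly_uminus_first: "lie_poly n (A(1 := - X)) = - lie_poly n (A(1 := X))"
  using lie_poly_add_first[of n A X "- X"] lie_poly_zero_first[of n A]
  by (simp add: eq_neg_iff_add_eq_0 add.commute)

lemma lie_poly_compose_first:
  assumes "W \<in> center U" "\<And>i. i \<in> {1..n} \<Longrightarrow> A i \<in> U"
  shows "lie_poly n (A(1 := W o\<^sub>L A 1)) = W o\<^sub>L lie_poly n A"
  using assms(2)
proof (induction n A rule: lie_poly.induct)
  case (3 n A)
  have *: "commutator (W o\<^sub>L X) Y = W o\<^sub>L commutator X Y" if "Y \<in> U" for X Y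
    using center_commute[OF assms(1) that]
    by (intro blinfun_eqI) (simp add: commutator_apply blinfun_simps)
  from 3 show ?case by (simp add: *)
qed simp_all

lemma lie_poly_central_first:
  assumes "n \<ge> 2" "Z \<in> center U" "\<And>i. i \<in> {1..n} \<Longrightarrow> A i \<in> U"
  shows "lie_poly n (A(1 := Z)) = 0"
  using assms(1,3)
proof (induction n rule: dec_induct)
  case base
  then show ?case using assms(2) by (simp add: numeral_2_eq_2 center_centralizes)
next
  case (step n)
  then obtain k where "n = Suc k" by (cases n) auto
  with step show ?case by simp
qed

text \<open>Brackets are nested to the left, so the innermost one can serve as the first entry of a
  shorter polynomial. This isolates the pair of arguments to be swapped.\<close>

lemma lie_poly_shift:
  "lie_poly (Suc (Suc n)) A
    = lie_poly (Suc n) ((\<lambda>i. A (Suc i))(1 := commutator (A 1) (A 2)))"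
  by (induction n) (simp_all add: numeral_2_eq_2)

text \<open>Induction removes the outermost bracket: its second entry is arbitrary and does not
  occur in the shorter polynomial, so \<open>central_if_commutators_central\<close> applies.\<close>

lemma central_if_lie_poly_central:
  assumes "D \<in> U"
    and "\<And>A. (\<And>i. A i \<in> U) \<Longrightarrow> lie_poly (Suc n) (A(1 := D)) \<in> center U"
  shows "D \<in> center U"
  using assms(2)
proof (induction n)
  case 0
  then show ?case using zero_in by fastforce
next
  case (Suc n)
  show ?case
  proof (rule Suc.IH)
    fix A :: "nat \<Rightarrow> 'h \<Rightarrow>\<^sub>L 'h" assume A: "\<And>i. A i \<in> U"
    show "lie_poly (Suc n) (A(1 := D)) \<in> center U"
    proof (rule central_if_commutators_central)
      show "lie_poly (Suc n) (A(1 := D)) \<in> U"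
        by (rule lie_poly_in) (use A assms(1) in auto)
      fix B assume B: "B \<in> U"
      have "lie_poly (Suc (Suc n)) ((A(Suc (Suc n) := B))(1 := D)) \<in> center U"
        by (rule Suc.prems) (use A B in auto)
      moreover have "lie_poly (Suc n) ((A(Suc (Suc n) := B))(1 := D)) = lie_poly (Suc n) (A(1 := D))"
        by (rule lie_poly_cong) auto
      ultimately show "commutator (lie_poly (Suc n) (A(1 := D))) B \<in> center U"
        by simp
    qed
  qed
qed

lemma additive_map_uminus:
  assumes "additive_map U V f" "A \<in> U"
  shows "f (- A) = - f A"
proof -
  have add: "\<And>A B. A \<in> U \<Longrightarrow> B \<in> U \<Longrightarrow> f (A + B) = f A + f B"
    using assms(1) by (simp add: additive_map_def)
  from add[of 0 0] have "f 0 = 0" by simp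
  with add[of A "- A"] assms(2) show ?thesis
    by (simp add: eq_neg_iff_add_eq_0 add.commute)
qed

text \<open>Swapping the first two arguments of \<open>p\<^sub>n\<close> changes its sign, so all further brackets of
  \<open>[\<phi> X, Y] + [\<phi> Y, X]\<close> vanish.\<close>

lemma lie_centralizer_commuting:
  assumes n: "n \<ge> 2" and additive: "additive_map U U \<phi>" and lie: "lie_centralizer n U \<phi>"
    and X: "X \<in> U" and Y: "Y \<in> U"
  shows "commutator (\<phi> X) Y = commutator X (\<phi> Y)"
proof -
  have phi: "\<And>A. A \<in> U \<Longrightarrow> \<phi> A \<in> U" "\<And>A B. A \<in> U \<Longrightarrow> B \<in> U \<Longrightarrow> \<phi> (A + B) = \<phi> A + \<phi> B"
    using additive by (auto simp: additive_map_def)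
  obtain m where m: "n = Suc (Suc m)"
    using n by (metis Suc_le_D numeral_2_eq_2 Suc_le_mono)
  have central: "commutator (\<phi> X) Y + commutator (\<phi> Y) X \<in> center U"
    if X: "X \<in> U" and Y: "Y \<in> U" for X Y
  proof (rule central_if_lie_poly_central)
    show "commutator (\<phi> X) Y + commutator (\<phi> Y) X \<in> U"
      using phi that by simp
    fix A :: "nat \<Rightarrow> 'h \<Rightarrow>\<^sub>L 'h" assume A: "\<And>i. A i \<in> U"
    have *: "lie_poly (Suc m) (A(1 := commutator (\<phi> X) Y))
        = \<phi> (lie_poly (Suc m) (A(1 := commutator X Y)))"
      if X: "X \<in> U" and Y: "Y \<in> U" for X Y
    proof -
      \<comment> \<open>\<open>X\<close> and \<open>Y\<close> are put in front of the entries of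
        \<open>A\<close> from the second on, so that \<open>lie_poly n B\<close> is the shorter
        polynomial with first entry \<open>commutator X Y\<close>.\<close>
      define B where "B i = (if i = 1 then X else if i = 2 then Y else A (i - 1))" for i :: nat
      have shift: "lie_poly n (B(1 := Z)) = lie_poly (Suc m) (A(1 := commutator Z Y))" for Z
        unfolding m lie_poly_shift by (rule lie_poly_cong) (auto simp: B_def)
      have "\<phi> (lie_poly n B) = lie_poly n (B(1 := \<phi> X))"
        using lie A X Y unfolding lie_centralizer_def by (auto simp: B_def)
      moreover have "B(1 := X) = B" by (auto simp: B_def)
      ultimately show ?thesis using shift by metis
    qed
    have "lie_poly (Suc m) (A(1 := commutator (\<phi> X) Y + commutator (\<phi> Y) X))
        = \<phi> (lie_poly (Suc m) (A(1 := commutator X Y)))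
          + \<phi> (lie_poly (Suc m) (A(1 := commutator Y X)))"
      using X Y by (simp only: lie_poly_add_first *)
    also have "lie_poly (Suc m) (A(1 := commutator Y X)) = - lie_poly (Suc m) (A(1 := commutator X Y))"
      by (metis commutator_swap lie_poly_uminus_first)
    also have "\<phi> (- lie_poly (Suc m) (A(1 := commutator X Y)))
        = - \<phi> (lie_poly (Suc m) (A(1 := commutator X Y)))"
      by (rule additive_map_uminus[OF additive], rule lie_poly_in) (use A X Y in auto)
    finally show "lie_poly (Suc m) (A(1 := commutator (\<phi> X) Y + commutator (\<phi> Y) X)) \<in> center U"
      by (simp only: add.right_inverse zero_center)
  qed
  \<comment> \<open>\<open>central\<close> concerns a sum of two commutators, out of reach of
    \<open>central_commutator_zero\<close>. For \<open>Y = X\<close> it is twice a single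
    commutator; polarization then recovers general \<open>Y\<close>.\<close>
  have zero: "commutator (\<phi> X) X = 0" if "X \<in> U" for X
  proof (rule central_commutator_zero)
    have "commutator (\<phi> X) X = scaleC_op (1/2) (commutator (\<phi> X) X + commutator (\<phi> X) X)"
      by (rule blinfun_eqI)
        (simp add: blinfun_simps scaleC_add_right flip: scaleC_add_left)
    with center_scaleC[OF central[OF that that]] show "commutator (\<phi> X) X \<in> center U"
      by metis
  qed (use phi that in auto)
  have "commutator (\<phi> X) Y + commutator (\<phi> Y) X = 0"
    using zero[of "X + Y"] zero[of X] zero[of Y] X Y
    by (simp add: phi commutator_add_left commutator_add_right add.commute)
  moreover have "commutator X (\<phi> Y) + commutator (\<phi> Y) X = 0"
    by (simp add: commutator_def)
  ultimately show ?thesis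
    by (metis add_right_imp_eq)
qed

end

section \<open>Bounded selections from closed linear relations\<close>

text \<open>Baire's theorem in the complete space \<open>S\<close>: the closures of the
  \<open>A n\<close> stay inside \<open>S\<close> and cover it, so one of them has relative
  interior.\<close>

lemma Baire_closed_union:
  fixes A :: "nat \<Rightarrow> 'a::banach set"
  assumes S: "closed S" "S \<noteq> {}" "S = (\<Union>n. A n)"
  obtains n x r where "x \<in> S" "r > 0" "ball x r \<inter> S \<subseteq> closure (A n)"
proof -
  let ?X = "top_of_set S" and ?G = "range (\<lambda>n. closure (A n))"
  have sub: "closure (A n) \<subseteq> S" for n
    using S by (intro closure_minimal) auto
  have "\<exists>n. ?X interior_of closure (A n) \<noteq> {}"
  proof (rule ccontr)
    assume none: "\<not> ?thesis"
    have "?X interior_of \<Union>?G = {}"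
    proof (rule Baire_category_alt)
      show "completely_metrizable_space ?X \<or> locally_compact_space ?X \<and> regular_space ?X"
        using S(1) completely_metrizable_space_closedin completely_metrizable_space_euclidean
        by (metis closed_closedin)
      fix T assume "T \<in> ?G"
      then show "closedin ?X T \<and> ?X interior_of T = {}"
        using none sub closed_subset[OF sub closed_closure] by auto
    qed auto
    moreover have "\<Union>?G = topspace ?X"
      using sub S(3) closure_subset[of "A _"] by (simp, blast)
    ultimately show False
      using S(2) by (metis interior_of_topspace topspace_euclidean_subtopology)
  qed
  then obtain n x where "x \<in> ?X interior_of closure (A n)" by blast
  then obtain V where V: "openin ?X V" "x \<in> V" "V \<subseteq> closure (A n)"
    unfolding interior_of_def by blast
  then obtain r where "r > 0" "ball x r \<inter> S \<subseteq> V"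
    unfolding openin_contains_ball by blast
  with V that[of x r n] show thesis
    using openin_subset[OF V(1)] by (metis subsetD subset_trans topspace_euclidean_subtopology)
qed

text \<open>The open mapping theorem for the projection of \<open>G\<close> onto its first coordinate: by Baire, vectors
  of \<open>fst ` G\<close> are approximated up to half of their norm with control on the second coordinate, and
  the errors are summed up.\<close>

lemma closed_relation_bounded_selection:
  fixes G :: "('a::banach \<times> 'b::banach) set"
  assumes G: "closed G" "subspace G" and dom: "closed (fst ` G)"
  obtains C where "C > 0" "\<And>x. x \<in> fst ` G \<Longrightarrow> \<exists>w. (x, w) \<in> G \<and> norm w \<le> C * norm x"
proof -
  define S where "S = fst ` G"
  define A where "A n = {x. \<exists>w. (x, w) \<in> G \<and> norm w \<le> real n}" for n
  have G0: "(0, 0) \<in> G" using subspace_0[OF G(2)] by (simp add: zero_prod_def)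
  have Gadd: "(x + y, v + w) \<in> G" if "(x, v) \<in> G" "(y, w) \<in> G" for x y v w
    using subspace_add[OF G(2) that] by simp
  have Gdiff: "(x - y, v - w) \<in> G" if "(x, v) \<in> G" "(y, w) \<in> G" for x y v w
    using subspace_diff[OF G(2) that] by simp
  have Gscale: "(r *\<^sub>R x, r *\<^sub>R w) \<in> G" if "(x, w) \<in> G" for r x w
    using subspace_scale[OF G(2) that] by simp
  have inS: "x \<in> S" if "(x, w) \<in> G" for x w
    using that unfolding S_def by force
  have "S = (\<Union>n. A n)"
    by (auto simp: S_def A_def) (metis real_arch_simple, force)
  moreover have "S \<noteq> {}" using G0 inS by blast
  ultimately obtain n x0 r where r: "x0 \<in> S" "r > 0" "ball x0 r \<inter> S \<subseteq> closure (A n)"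
    using Baire_closed_union[of S A] dom S_def by metis
  \<comment> \<open>\<open>x\<close> is the difference of \<open>x0 + x\<close> and
    \<open>x0\<close>, both approximable from \<open>A n\<close>; subtracting the approximants
    doubles the bound \<open>n\<close>.\<close>
  have small: "\<exists>a w. (a, w) \<in> G \<and> norm w \<le> 2 * real n \<and> norm (x - a) \<le> e"
    if x: "x \<in> S" "norm x < r" and e: "e > 0" for x e
  proof -
    have "x0 + x \<in> S" using r(1) x(1) Gadd unfolding S_def by force
    then have "x0 + x \<in> closure (A n)" "x0 \<in> closure (A n)"
      using r x by (auto simp: dist_norm)
    then obtain a b where ab: "a \<in> A n" "dist a (x0 + x) < e / 2" "b \<in> A n" "dist b x0 < e / 2"
      using e unfolding closure_approachable by (meson half_gt_zero)
    then obtain v w where vw: "(a, v) \<in> G" "norm v \<le> real n" "(b, w) \<in> G" "norm w \<le> real n"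
      by (auto simp: A_def)
    have "norm (x - (a - b)) \<le> e"
      using ab(2,4) norm_triangle_ineq4[of "b - x0" "a - (x0 + x)"]
      by (simp add: dist_norm algebra_simps)
    moreover have "norm (v - w) \<le> 2 * real n"
      using vw(2,4) norm_triangle_ineq4[of v w] by linarith
    ultimately show ?thesis using Gdiff[OF vw(1,3)] by blast
  qed
  \<comment> \<open>Rescaling \<open>x\<close> to norm \<open>r / 2\<close> and applying
    \<open>small\<close> with error \<open>r / 4\<close> halves the norm; scaling back turns the
    bound \<open>2 * n\<close> into \<open>4 * n / r * norm x\<close>.\<close>
  define M where "M = 4 * real n / r"
  have M: "M \<ge> 0" using r(2) by (simp add: M_def)
  have "\<exists>a w. (a, w) \<in> G \<and> norm w \<le> M * norm x \<and> norm (x - a) \<le> norm x / 2" if x: "x \<in> S" for x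
  proof (cases "x = 0")
    case True
    then show ?thesis using G0 by force
  next
    case False
    define t where "t = r / (2 * norm x)"
    have t: "t > 0" using False r(2) by (simp add: t_def)
    have nt: "norm (t *\<^sub>R x) = r / 2" using False r(2) by (simp add: t_def)
    have "t *\<^sub>R x \<in> S" using x Gscale unfolding S_def by force
    then obtain a w where aw: "(a, w) \<in> G" "norm w \<le> 2 * real n" "norm (t *\<^sub>R x - a) \<le> r / 4"
      using small[of "t *\<^sub>R x" "r / 4"] nt r(2) by auto
    have "norm (x - (1/t) *\<^sub>R a) = norm (t *\<^sub>R x - a) / t"
    proof -
      have "x - (1/t) *\<^sub>R a = (1/t) *\<^sub>R (t *\<^sub>R x - a)"
        using t by (simp add: scaleR_diff_right)
      then show ?thesis using t by simp
    qed
    also have "\<dots> \<le> norm x / 2"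
      using aw(3) t False r(2) by (simp add: t_def field_simps)
    finally have "norm (x - (1/t) *\<^sub>R a) \<le> norm x / 2" .
    moreover have "norm ((1/t) *\<^sub>R w) \<le> M * norm x"
    proof -
      have "norm ((1/t) *\<^sub>R w) = norm w / t" using t by simp
      also have "\<dots> \<le> 2 * real n / t" using aw(2) t by (simp add: divide_right_mono)
      also have "\<dots> = M * norm x" using False r(2) by (simp add: t_def M_def)
      finally show ?thesis .
    qed
    ultimately show ?thesis using Gscale[OF aw(1), of "1/t"] by blast
  qed
  then obtain a w where aw: "\<And>x. x \<in> S \<Longrightarrow> (a x, w x) \<in> G"
      "\<And>x. x \<in> S \<Longrightarrow> norm (w x) \<le> M * norm x" "\<And>x. x \<in> S \<Longrightarrow> norm (x - a x) \<le> norm x / 2"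
    by metis
  \<comment> \<open>The norms of the errors \<open>y k\<close> at least halve each time, so the
    corrections sum to at most \<open>2 * M * norm x\<close>; the \<open>+ 1\<close> keeps the
    constant positive if \<open>M = 0\<close>.\<close>
  have "\<exists>v. (x, v) \<in> G \<and> norm v \<le> (2 * M + 1) * norm x" if x: "x \<in> S" for x
  proof -
    define y where "y k = ((\<lambda>z. z - a z) ^^ k) x" for k
    have y_Suc: "y (Suc k) = y k - a (y k)" for k
      by (simp add: y_def)
    have yS: "y k \<in> S" for k
    proof (induction k)
      case (Suc k)
      then obtain u where "(y k, u) \<in> G" unfolding S_def by force
      from Gdiff[OF this aw(1)[OF Suc]] show ?case unfolding y_Suc by (rule inS)
    qed (simp add: y_def x)
    have ny: "norm (y k) \<le> norm x * (1/2) ^ k" for k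
    proof (induction k)
      case (Suc k)
      then show ?case using aw(3)[OF yS[of k]] by (simp add: y_Suc)
    qed (simp add: y_def)
    have nw: "norm (w (y k)) \<le> M * norm x * (1/2) ^ k" for k
      using order.trans[OF aw(2)[OF yS] mult_left_mono[OF ny M]] by (simp add: mult.assoc)
    have geo: "summable (\<lambda>k. M * norm x * (1/2 :: real) ^ k)"
      by (intro summable_mult summable_geometric) simp
    have sum: "summable (\<lambda>k. norm (w (y k)))"
      by (rule summable_comparison_test'[OF geo, of 0]) (use nw in simp)
    have part: "(x - y N, \<Sum>k<N. w (y k)) \<in> G" for N
    proof (induction N)
      case (Suc N)
      from Gadd[OF this aw(1)[OF yS[of N]]] show ?case
        by (simp add: y_Suc diff_diff_eq2 diff_add_eq)
    qed (simp add: y_def G0)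
    have "y \<longlonglongrightarrow> 0"
    proof (rule Lim_null_comparison[of _ "\<lambda>k. norm x * (1/2) ^ k"])
      show "(\<lambda>k. norm x * (1/2) ^ k) \<longlonglongrightarrow> 0"
        by (intro tendsto_mult_right_zero LIMSEQ_realpow_zero) auto
    qed (use ny in simp)
    then have "(\<lambda>N. (x - y N, \<Sum>k<N. w (y k))) \<longlonglongrightarrow> (x - 0, \<Sum>k. w (y k))"
      by (intro tendsto_intros summable_LIMSEQ summable_norm_cancel[OF sum])
    then have "(x, \<Sum>k. w (y k)) \<in> G"
      using closed_sequentially[OF G(1)] part by fastforce
    moreover have "norm (\<Sum>k. w (y k)) \<le> (2 * M + 1) * norm x"
    proof -
      have "norm (\<Sum>k. w (y k)) \<le> (\<Sum>k. norm (w (y k)))"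
        by (rule summable_norm[OF sum])
      also have "\<dots> \<le> (\<Sum>k. M * norm x * (1/2) ^ k)"
        by (rule suminf_le[OF nw sum geo])
      also have "\<dots> = 2 * M * norm x"
        by (subst suminf_mult) (simp_all add: suminf_geometric summable_geometric)
      also have "\<dots> \<le> (2 * M + 1) * norm x" by (simp add: mult_right_mono)
      finally show ?thesis .
    qed
    ultimately show ?thesis by blast
  qed
  then show thesis
    using M unfolding S_def by (intro that[of "2 * M + 1"]) auto
qed

section \<open>Self-adjoint commuting maps\<close>

lemma commutator_compose_left:
  "commutator (X o\<^sub>L Y) Z = (X o\<^sub>L commutator Y Z) + (commutator X Z o\<^sub>L Y)"
  by (rule blinfun_eqI) (simp add: commutator_apply blinfun_simps)

lemma commutator_compose_right:
  "commutator X (Y o\<^sub>L Z) = (commutator X Y o\<^sub>L Z) + (Y o\<^sub>L commutator X Z)"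
  by (rule blinfun_eqI) (simp add: commutator_apply blinfun_simps)

text \<open>\<open>comm\<close> carries linearity modulo the center:
  \<open>f (X + Y) - f X - f Y\<close> has zero bracket with every \<open>Z\<close> in
  \<open>U\<close>, since \<open>f\<close> can be moved onto \<open>Z\<close>.\<close>

locale commuting_map = von_neumann U
  for U :: "('h::complex_hilbert_space \<Rightarrow>\<^sub>L 'h) set" +
  fixes f :: "('h \<Rightarrow>\<^sub>L 'h) \<Rightarrow> ('h \<Rightarrow>\<^sub>L 'h)"
  assumes in_U [simp]: "X \<in> U \<Longrightarrow> f X \<in> U"
    and comm: "X \<in> U \<Longrightarrow> Y \<in> U \<Longrightarrow> commutator (f X) Y = commutator X (f Y)"
begin

lemma funpow_in [simp]: "X \<in> U \<Longrightarrow> (f ^^ m) X \<in> U"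
  by (induction m) simp_all

text \<open>Expanding \<open>[f (X V), Y Z]\<close> by the Leibniz rule in both orders.\<close>

lemma commutator_exchange:
  assumes X: "X \<in> U" "Y \<in> U" "V \<in> U" "Z \<in> U"
  shows "commutator (f X) Y (commutator V Z h) = commutator X Y (commutator (f V) Z h)"
proof -
  \<comment> \<open>\<open>comm\<close> moves \<open>f\<close> to \<open>Q\<close>, the Leibniz rule
    splits the product, and \<open>comm\<close> moves \<open>f\<close> back onto each
    factor.\<close>
  have left: "commutator (f (X o\<^sub>L V)) Q = (X o\<^sub>L commutator (f V) Q) + (commutator (f X) Q o\<^sub>L V)"
    if "Q \<in> U" for Q
    using X that by (simp add: comm commutator_compose_left)
  have "(commutator (f (X o\<^sub>L V)) Y o\<^sub>L Z) + (Y o\<^sub>L commutator (f (X o\<^sub>L V)) Z)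
      = (X o\<^sub>L commutator (f V) (Y o\<^sub>L Z)) + (commutator (f X) (Y o\<^sub>L Z) o\<^sub>L V)"
    using X by (simp flip: left commutator_compose_right)
  then have "((commutator (f (X o\<^sub>L V)) Y o\<^sub>L Z) + (Y o\<^sub>L commutator (f (X o\<^sub>L V)) Z)) h
      = ((X o\<^sub>L commutator (f V) (Y o\<^sub>L Z)) + (commutator (f X) (Y o\<^sub>L Z) o\<^sub>L V)) h"
    by simp
  then have "X (commutator (f V) Y (Z h)) + commutator (f X) Y (V (Z h))
        + (Y (X (commutator (f V) Z h)) + Y (commutator (f X) Z (V h)))
      = X (commutator (f V) Y (Z h)) + X (Y (commutator (f V) Z h))
        + (commutator (f X) Y (Z (V h)) + Y (commutator (f X) Z (V h)))"
    using X by (simp add: left commutator_compose_right blinfun_simps)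
  then have "commutator (f X) Y (V (Z h)) + Y (X (commutator (f V) Z h))
      = X (Y (commutator (f V) Z h)) + commutator (f X) Y (Z (V h))"
    by (simp add: algebra_simps)
  then have "commutator (f X) Y (V (Z h)) - commutator (f X) Y (Z (V h))
      = X (Y (commutator (f V) Z h)) - Y (X (commutator (f V) Z h))"
    by (simp add: algebra_simps)
  then show ?thesis
    by (simp add: commutator_apply[of V Z] commutator_apply[of X Y] blinfun.diff_right)
qed

text \<open>\<open>f\<close> itself need not be bounded: a bounded representative \<open>W\<close> of \<open>f\<^sup>m X\<close> modulo the center
  is chosen.\<close>

lemma funpow_bounded_modulo_center:
  obtains C where "C > 0" "\<And>m X. X \<in> U \<Longrightarrow>
    \<exists>W. norm W \<le> C ^ m * norm X \<and> (\<forall>Y\<in>U. commutator W Y = commutator ((f ^^ m) X) Y)"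
proof -
  \<comment> \<open>For \<open>X\<close> and \<open>W\<close> in \<open>U\<close>,
    \<open>(X, W)\<close> is in \<open>G\<close> exactly if \<open>W\<close> and \<open>f X\<close>
    differ by a central element. Written with \<open>f Y\<close> for fixed \<open>Y\<close>, each
    condition is closed and linear in the pair.\<close>
  define G where "G = {p. fst p \<in> U \<and> snd p \<in> U \<and>
    (\<forall>Y\<in>U. commutator (snd p) Y = commutator (fst p) (f Y))}"
  have cc: "closed {p :: ('h \<Rightarrow>\<^sub>L 'h) \<times> ('h \<Rightarrow>\<^sub>L 'h). commutator (snd p) Y = commutator (fst p) Z}" for Y Z
    by (intro closed_Collect_eq bounded_bilinear.continuous_on[OF bounded_bilinear_commutator]
        continuous_intros)
  have "G = (fst -` U) \<inter> (snd -` U) \<inter>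
      (\<Inter>Y\<in>U. {p. commutator (snd p) Y = commutator (fst p) (f Y)})"
    by (auto simp: G_def)
  moreover have "closed \<dots>"
    by (intro closed_Int closed_INT closed_vimage norm_closed continuous_intros ballI cc)
  ultimately have closed: "closed G" by simp
  have subspace: "subspace G"
    by (auto simp: G_def subspace_def commutator_add_left commutator_scaleR_left)
  have dom: "fst ` G = U"
  proof
    show "U \<subseteq> fst ` G"
    proof
      fix X assume X: "X \<in> U"
      then have "(X, f X) \<in> G" by (simp add: G_def comm)
      then show "X \<in> fst ` G" by force
    qed
  qed (auto simp: G_def)
  obtain C where C: "C > 0" "\<And>X. X \<in> U \<Longrightarrow> \<exists>W. (X, W) \<in> G \<and> norm W \<le> C * norm X"
    using closed_relation_bounded_selection[OF closed subspace] norm_closed unfolding dom by metis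
  have "\<exists>W\<in>U. norm W \<le> C ^ m * norm X \<and> (\<forall>Y\<in>U. commutator W Y = commutator ((f ^^ m) X) Y)"
    if X: "X \<in> U" for m X
  proof (induction m)
    case 0
    then show ?case using X by auto
  next
    case (Suc m)
    then obtain V where V: "V \<in> U" "norm V \<le> C ^ m * norm X"
        "\<And>Y. Y \<in> U \<Longrightarrow> commutator V Y = commutator ((f ^^ m) X) Y" by blast
    obtain W where W: "(V, W) \<in> G" "norm W \<le> C * norm V" using C(2)[OF V(1)] by blast
    have "commutator W Y = commutator ((f ^^ Suc m) X) Y" if Y: "Y \<in> U" for Y
      using W(1) V(3)[of "f Y"] X Y by (simp add: G_def comm)
    moreover have "norm W \<le> C ^ Suc m * norm X"
      using W(2) V(2) C(1) by (smt (verit) mult.assoc mult_left_mono power_Suc)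
    ultimately show ?case using W(1) by (auto simp: G_def)
  qed
  with C(1) that show thesis by blast
qed

end

locale selfadjoint_commuting_map = commuting_map U f
  for U :: "('h::complex_hilbert_space \<Rightarrow>\<^sub>L 'h) set" and f +
  assumes adj_f: "X \<in> U \<Longrightarrow> adj (f X) = f (adj X)"
begin

text \<open>The adjoint of a commutator is a commutator, and \<open>adj_f\<close> lets
  \<open>f\<close> pass through it; \<open>commutator_exchange\<close> then shifts \<open>f\<close>
  to the other side. For the multiplier T this says that <T s, T t> = <s, T (T t)>.\<close>

lemma cinner_exchange:
  assumes X: "X \<in> U" "Y \<in> U" "V \<in> U" "Z \<in> U"
  shows "cinner (commutator (f X) Y h) (commutator (f V) Z k)
    = cinner (commutator X Y h) (commutator (f (f V)) Z k)"
proof -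
  have "cinner (commutator (f X) Y h) (commutator (f V) Z k)
      = cinner h (commutator (adj Y) (f (adj X)) (commutator (f V) Z k))"
    using X by (simp flip: adj_f adj_commutator add: cinner_adj_right)
  also have "commutator (adj Y) (f (adj X)) (commutator (f V) Z k)
      = commutator (adj Y) (adj X) (commutator (f (f V)) Z k)"
    using X by (simp flip: comm add: commutator_exchange)
  also have "cinner h \<dots> = cinner (commutator X Y h) (commutator (f (f V)) Z k)"
    using X by (simp flip: adj_commutator add: cinner_adj_right)
  finally show ?thesis .
qed

lemma sum_commutators_bounded:
  "\<exists>C>0. \<forall>(I :: 'i set) X Y h. finite I \<longrightarrow> (\<forall>i\<in>I. X i \<in> U \<and> Y i \<in> U) \<longrightarrow>
    norm (\<Sum>i\<in>I. commutator (f (X i)) (Y i) (h i)) \<le> C * norm (\<Sum>i\<in>I. commutator (X i) (Y i) (h i))"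
proof -
  obtain C where C: "C > 0" "\<And>m X. X \<in> U \<Longrightarrow>
    \<exists>W. norm W \<le> C ^ m * norm X \<and> (\<forall>Y\<in>U. commutator W Y = commutator ((f ^^ m) X) Y)"
    by (rule funpow_bounded_modulo_center) metis
  have "norm (\<Sum>i\<in>I. commutator (f (X i)) (Y i) (h i)) \<le> C * norm (\<Sum>i\<in>I. commutator (X i) (Y i) (h i))"
    if I: "finite I" "\<And>i. i \<in> I \<Longrightarrow> X i \<in> U \<and> Y i \<in> U" for I :: "'i set" and X Y h
  proof -
    define s where "s m = (\<Sum>i\<in>I. commutator ((f ^^ m) (X i)) (Y i) (h i))" for m
    have "norm (s 1) \<le> C * norm (s 0)"
    proof (rule log_convex_growth[OF _ _ _ C(1)])
      fix m
      have "cinner (s (Suc m)) (s (Suc m)) = cinner (s m) (s (Suc (Suc m)))"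
        unfolding s_def cinner_sum_left cinner_sum_right
        using I(2) by (intro sum.cong refl) (simp add: cinner_exchange)
      then show "(norm (s (Suc m)))\<^sup>2 \<le> norm (s m) * norm (s (Suc (Suc m)))"
        by (metis Re_cinner_le Re_cinner_self)
      \<comment> \<open>The sum in front of \<open>C ^ m\<close> depends on the chosen summands;
        \<open>log_convex_growth\<close> discards it and keeps only \<open>C\<close>.\<close>
      show "norm (s m) \<le> (\<Sum>i\<in>I. 2 * norm (X i) * norm (Y i) * norm (h i)) * C ^ m"
        unfolding s_def sum_distrib_right
      proof (rule sum_norm_le)
        fix i assume i: "i \<in> I"
        obtain W where W: "norm W \<le> C ^ m * norm (X i)"
            "commutator W (Y i) = commutator ((f ^^ m) (X i)) (Y i)"
          using C(2)[of "X i" m] I(2)[OF i] by blast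
        have "norm (commutator W (Y i) (h i)) \<le> norm (commutator W (Y i)) * norm (h i)"
          by (rule norm_blinfun)
        also have "\<dots> \<le> (2 * norm W * norm (Y i)) * norm (h i)"
          by (intro mult_right_mono norm_commutator) simp
        also have "\<dots> \<le> (2 * (C ^ m * norm (X i)) * norm (Y i)) * norm (h i)"
          using W(1) by (intro mult_right_mono mult_left_mono) simp_all
        finally show "norm (commutator ((f ^^ m) (X i)) (Y i) (h i))
            \<le> 2 * norm (X i) * norm (Y i) * norm (h i) * C ^ m"
          using W(2) by (simp add: mult_ac)
      qed
    qed simp
    then show ?thesis by (simp add: s_def)
  qed
  with C(1) show ?thesis by (intro exI[of _ C]) blast
qed

end

section \<open>Approximate units\<close>

text \<open>Here \<open>\<parallel>a x\<parallel>\<^sup>2 \<le> \<langle>a x, x\<rangle>\<close> encodes \<open>0 \<le> a \<le> 1\<close>.\<close>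

locale positive_contraction =
  fixes a :: "'h::complex_hilbert_space \<Rightarrow>\<^sub>L 'h"
  assumes symmetric: "cinner (a x) y = cinner x (a y)"
    and norm_sq_le: "(norm (a x))\<^sup>2 \<le> Re (cinner (a x) x)"
begin

text \<open>The n-th power of 1 - a; the identity minus this power is the approximate unit built
  from \<open>a\<close>.\<close>

definition complement_power :: "nat \<Rightarrow> 'h \<Rightarrow> 'h" where
  "complement_power n x = ((\<lambda>x. x - a x) ^^ n) x"

lemma complement_power_0 [simp]: "complement_power 0 x = x"
  and complement_power_Suc: "complement_power (Suc n) x = complement_power n x - a (complement_power n x)"
  by (simp_all add: complement_power_def)

lemma complement_power_Suc': "complement_power (Suc n) x = complement_power n (x - a x)"
  by (induction n) (simp_all add: complement_power_Suc)

lemma complement_power_add: "complement_power (m + n) x = complement_power m (complement_power n x)"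
  by (simp add: complement_power_def funpow_add)

lemma complement_power_diff:
  "complement_power n (x - y) = complement_power n x - complement_power n y"
  by (induction n) (simp_all add: complement_power_Suc blinfun_simps)

lemma complement_power_symmetric:
  "cinner (complement_power n x) y = cinner x (complement_power n y)"
proof (induction n arbitrary: y)
  case (Suc n)
  have "cinner (complement_power (Suc n) x) y = cinner (complement_power n x) (y - a y)"
    by (simp add: complement_power_Suc cinner_diff_left cinner_diff_right symmetric)
  then show ?case by (simp add: Suc complement_power_Suc')
qed simp

text \<open>Expand the square of norm (k - a k) for the n-th iterate k; \<open>norm_sq_le\<close>
  absorbs one of the two copies of Re <a k, k>.\<close>

lemma norm_complement_power_decreasing:
  "Re (cinner (a (complement_power n x)) (complement_power n x))
    \<le> (norm (complement_power n x))\<^sup>2 - (norm (complement_power (Suc n) x))\<^sup>2"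
proof -
  let ?k = "complement_power n x"
  have "Re (cinner ?k (a ?k)) = Re (cinner (a ?k) ?k)" by (simp add: symmetric)
  then show ?thesis
    using norm_diff_squared[of ?k "a ?k"] norm_sq_le[of ?k] by (simp add: complement_power_Suc)
qed

lemma Re_cinner_nonneg: "0 \<le> Re (cinner (a x) x)"
  using norm_sq_le[of x] by (rule order_trans[rotated]) simp

lemma norm_complement_power_le: "norm (complement_power n x) \<le> norm x"
proof (induction n)
  case (Suc n)
  have "(norm (complement_power (Suc n) x))\<^sup>2 \<le> (norm (complement_power n x))\<^sup>2"
    using norm_complement_power_decreasing[of n x] Re_cinner_nonneg[of "complement_power n x"]
    by linarith
  then have "norm (complement_power (Suc n) x) \<le> norm (complement_power n x)"
    by (rule power2_le_imp_le) simp
  with Suc show ?case by simp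
qed simp

text \<open>The squared norms decrease to a limit, so their successive differences, which dominate
  these quantities, tend to 0.\<close>

lemma cinner_complement_power_tendsto_0:
  "(\<lambda>n. Re (cinner (a (complement_power n x)) (complement_power n x))) \<longlonglongrightarrow> 0"
proof -
  let ?c = "\<lambda>n. (norm (complement_power n x))\<^sup>2"
  have "decseq ?c"
    unfolding decseq_Suc_iff
  proof
    fix n
    show "?c (Suc n) \<le> ?c n"
      using norm_complement_power_decreasing[of n x] Re_cinner_nonneg[of "complement_power n x"]
      by linarith
  qed
  then obtain l where l: "?c \<longlonglongrightarrow> l"
    by (rule decseq_convergent[of ?c 0]) simp_all
  have "(\<lambda>n. ?c n - ?c (Suc n)) \<longlonglongrightarrow> l - l"
    by (intro tendsto_diff l LIMSEQ_Suc[OF l])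
  then have "(\<lambda>n. ?c n - ?c (Suc n)) \<longlonglongrightarrow> 0" by simp
  from tendsto_sandwich[OF _ _ tendsto_const this] show ?thesis
    by (auto simp: Re_cinner_nonneg norm_complement_power_decreasing)
qed

lemma complement_power_tendsto_0:
  assumes adjoint: "is_adjoint S R" and le: "\<And>x. (norm (R x))\<^sup>2 \<le> N * Re (cinner (a x) x)"
  shows "(\<lambda>n. complement_power n (S h)) \<longlonglongrightarrow> 0"
proof -
  \<comment> \<open>The exponent is doubled because symmetry turns the squared norm of the n-th
    iterate of \<open>S h\<close> into \<open>cinner h (R (?k n))\<close>, and \<open>le\<close>
    controls \<open>R\<close>.\<close>
  let ?k = "\<lambda>n. complement_power (n + n) (S h)"
  have "strict_mono (\<lambda>n::nat. n + n)" by (rule strict_monoI) simp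
  then have lim: "(\<lambda>n. N * Re (cinner (a (?k n)) (?k n))) \<longlonglongrightarrow> 0"
    using LIMSEQ_subseq_LIMSEQ[OF cinner_complement_power_tendsto_0[of "S h"]]
    by (intro tendsto_mult_right_zero) (simp add: o_def)
  have "(\<lambda>n. (norm (R (?k n)))\<^sup>2) \<longlonglongrightarrow> 0"
    by (rule tendsto_sandwich[OF _ _ tendsto_const lim]) (auto simp: le)
  then have "(\<lambda>n. norm (R (?k n))) \<longlonglongrightarrow> 0"
    by (simp add: power_tendsto_0_iff)
  then have lim': "(\<lambda>n. norm h * norm (R (?k n))) \<longlonglongrightarrow> 0"
    by (rule tendsto_mult_right_zero)
  have le': "(norm (complement_power n (S h)))\<^sup>2 \<le> norm h * norm (R (?k n))" for n
  proof -
    have "cinner (complement_power n (S h)) (complement_power n (S h)) = cinner h (R (?k n))"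
      using adjoint by (simp add: complement_power_symmetric is_adjoint_def complement_power_add)
    then show ?thesis
      by (metis Re_cinner_le Re_cinner_self)
  qed
  have "(\<lambda>n. (norm (complement_power n (S h)))\<^sup>2) \<longlonglongrightarrow> 0"
    by (rule tendsto_sandwich[OF _ _ tendsto_const lim']) (auto simp: le')
  then show ?thesis
    by (simp add: power_tendsto_0_iff tendsto_norm_zero_iff)
qed

end

section \<open>Sums of \<open>S o\<^sub>L adj S\<close> as positive contractions\<close>

context von_neumann
begin

lemma positive_contraction_sum:
  assumes P: "finite P" "P \<subseteq> U"
  obtains N where "N > 0" "positive_contraction ((1 / N) *\<^sub>R (\<Sum>S\<in>P. S o\<^sub>L adj S))"
    "\<And>S x. S \<in> P \<Longrightarrow>
      (norm (adj S x))\<^sup>2 \<le> N * Re (cinner (((1 / N) *\<^sub>R (\<Sum>S\<in>P. S o\<^sub>L adj S)) x) x)"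
proof -
  define b where "b = (\<Sum>S\<in>P. S o\<^sub>L adj S)"
  \<comment> \<open>Cauchy-Schwarz bounds the square of \<open>norm (b x)\<close> by the sum of the
    squares of \<open>norm S\<close> times \<open>Re (cinner (b x) x)\<close>; the
    \<open>1 +\<close> keeps \<open>N\<close> positive for empty \<open>P\<close>.\<close>
  define N where "N = 1 + (\<Sum>S\<in>P. (norm S)\<^sup>2)"
  have N: "N > 0" by (simp add: N_def add_pos_nonneg sum_nonneg)
  have PU: "S \<in> U" if "S \<in> P" for S using that P(2) by blast
  have b_apply: "b x = (\<Sum>S\<in>P. S (adj S x))" for x
    by (simp add: b_def blinfun.sum_left)
  have Re_b: "Re (cinner (b x) x) = (\<Sum>S\<in>P. (norm (adj S x))\<^sup>2)" for x
    unfolding b_apply cinner_sum_left Re_sum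
    by (intro sum.cong refl)
      (metis PU Re_cinner_self adj_adj adj_in cinner_adj_left cinner_adj_right)
  have norm_b: "(norm (b x))\<^sup>2 \<le> N * Re (cinner (b x) x)" for x
  proof -
    have "norm (b x) \<le> (\<Sum>S\<in>P. norm S * norm (adj S x))"
      unfolding b_apply by (intro sum_norm_le norm_blinfun)
    then have "(norm (b x))\<^sup>2 \<le> (\<Sum>S\<in>P. norm S * norm (adj S x))\<^sup>2"
      by (simp add: power_mono)
    also have "\<dots> \<le> (\<Sum>S\<in>P. (norm S)\<^sup>2) * (\<Sum>S\<in>P. (norm (adj S x))\<^sup>2)"
      by (rule Cauchy_Schwarz_ineq_sum)
    also have "\<dots> \<le> N * Re (cinner (b x) x)"
      unfolding Re_b by (intro mult_right_mono) (simp_all add: N_def sum_nonneg)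
    finally show ?thesis .
  qed
  have sym: "cinner (b x) y = cinner x (b y)" for x y
    unfolding b_apply cinner_sum_left cinner_sum_right
    by (intro sum.cong refl) (metis PU cinner_adj_left cinner_adj_right adj_adj adj_in)
  have Re_scaled: "Re (cinner (((1 / N) *\<^sub>R b) x) x) = Re (cinner (b x) x) / N" for x
    by (simp add: blinfun.scaleR_left cinner_scaleR_left)
  have "positive_contraction ((1 / N) *\<^sub>R b)"
  proof
    show "cinner (((1 / N) *\<^sub>R b) x) y = cinner x (((1 / N) *\<^sub>R b) y)" for x y
      by (simp add: blinfun.scaleR_left cinner_scaleR_left cinner_scaleR_right sym)
    fix x
    have "(norm (((1 / N) *\<^sub>R b) x))\<^sup>2 = (norm (b x))\<^sup>2 / N\<^sup>2"
      using N by (simp add: blinfun.scaleR_left power_divide)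
    also have "\<dots> \<le> N * Re (cinner (b x) x) / N\<^sup>2"
      by (rule divide_right_mono[OF norm_b]) simp
    also have "\<dots> = Re (cinner (b x) x) / N"
      using N by (simp add: power2_eq_square)
    finally show "(norm (((1 / N) *\<^sub>R b) x))\<^sup>2 \<le> Re (cinner (((1 / N) *\<^sub>R b) x) x)"
      by (simp only: Re_scaled)
  qed
  moreover have "(norm (adj S x))\<^sup>2 \<le> N * Re (cinner (((1 / N) *\<^sub>R b) x) x)" if "S \<in> P" for S x
    using member_le_sum[OF that, of "\<lambda>S. (norm (adj S x))\<^sup>2"] P(1) N
    by (simp only: Re_scaled Re_b) simp
  ultimately show thesis using N that unfolding b_def by blast
qed

end

lemma subspace_closure:
  fixes S :: "'a::real_normed_vector set"
  assumes "subspace S"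
  shows "subspace (closure S)"
  unfolding subspace_def
proof (intro conjI ballI allI)
  show "0 \<in> closure S" using subspace_0[OF assms] closure_subset by blast
  show "x + y \<in> closure S" if x: "x \<in> closure S" and y: "y \<in> closure S" for x y
  proof -
    obtain s where s: "\<forall>n. s n \<in> S" "s \<longlonglongrightarrow> x"
      using x unfolding closure_sequential by blast
    obtain t where t: "\<forall>n. t n \<in> S" "t \<longlonglongrightarrow> y"
      using y unfolding closure_sequential by blast
    show ?thesis
      unfolding closure_sequential
      using s t by (intro exI[of _ "\<lambda>n. s n + t n"]) (simp add: subspace_add[OF assms] tendsto_add)
  qed
  show "c *\<^sub>R x \<in> closure S" if x: "x \<in> closure S" for c x
  proof -
    obtain s where s: "\<forall>n. s n \<in> S" "s \<longlonglongrightarrow> x"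
      using x unfolding closure_sequential by blast
    show ?thesis
      unfolding closure_sequential
      using s by (intro exI[of _ "\<lambda>n. c *\<^sub>R s n"]) (simp add: subspace_scale[OF assms] tendsto_scaleR)
  qed
qed

section \<open>The central multiplier of a self-adjoint commuting map\<close>

context von_neumann
begin

text \<open>A real span; it is a complex subspace because complex scalars are absorbed by
  \<open>h\<close>.\<close>

definition commutator_vectors :: "'h set" where
  "commutator_vectors = span {commutator X Y h |X Y h. X \<in> U \<and> Y \<in> U}"

lemma commutator_vectorsI:
  "X \<in> U \<Longrightarrow> Y \<in> U \<Longrightarrow> commutator X Y h \<in> commutator_vectors"
  unfolding commutator_vectors_def by (rule span_base) blast

lemma subspace_commutator_vectors: "subspace commutator_vectors"
  by (simp add: commutator_vectors_def)

text \<open>The spanning vectors index themselves, and their real coefficients go into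
  \<open>h\<close>.\<close>

lemma commutator_vectorsE:
  assumes "s \<in> commutator_vectors"
  obtains I :: "'h set" and X Y h where "finite I" "\<And>i. i \<in> I \<Longrightarrow> X i \<in> U \<and> Y i \<in> U"
    "s = (\<Sum>i\<in>I. commutator (X i) (Y i) (h i))"
proof -
  obtain I r where I: "finite I" "I \<subseteq> {commutator X Y h |X Y h. X \<in> U \<and> Y \<in> U}"
      "s = (\<Sum>v\<in>I. r v *\<^sub>R v)"
    using assms unfolding commutator_vectors_def span_explicit by blast
  have "\<forall>v\<in>I. \<exists>X Y h. X \<in> U \<and> Y \<in> U \<and> v = commutator X Y h"
    using I(2) by blast
  then obtain X Y h where XYh: "\<And>v. v \<in> I \<Longrightarrow> X v \<in> U \<and> Y v \<in> U \<and> v = commutator (X v) (Y v) (h v)"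
    unfolding bchoice_iff by blast
  have "s = (\<Sum>v\<in>I. commutator (X v) (Y v) (r v *\<^sub>R h v))"
    unfolding I(3)
  proof (intro sum.cong refl)
    fix v assume "v \<in> I"
    then have "commutator (X v) (Y v) (h v) = v" using XYh by simp
    then show "r v *\<^sub>R v = commutator (X v) (Y v) (r v *\<^sub>R h v)"
      by (simp only: blinfun.scaleR_right)
  qed
  with that[of I X Y "\<lambda>v. r v *\<^sub>R h v"] I(1) XYh show thesis by simp
qed

lemma scaleC_commutator_vectors:
  assumes "s \<in> commutator_vectors"
  shows "c *\<^sub>C s \<in> commutator_vectors"
proof -
  obtain I :: "'h set" and X Y h where I: "\<And>i. i \<in> I \<Longrightarrow> X i \<in> U \<and> Y i \<in> U"
      "s = (\<Sum>i\<in>I. commutator (X i) (Y i) (h i))"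
    using commutator_vectorsE[OF assms] by metis
  have "c *\<^sub>C s = (\<Sum>i\<in>I. commutator (X i) (Y i) (c *\<^sub>C h i))"
    unfolding I(2) scaleC_sum_right by (intro sum.cong refl) (simp add: I(1) scaleC_apply)
  then show ?thesis
    using I(1) by (simp add: subspace_sum subspace_commutator_vectors commutator_vectorsI)
qed

lemma scaleC_closure_commutator_vectors:
  assumes "s \<in> closure commutator_vectors"
  shows "c *\<^sub>C s \<in> closure commutator_vectors"
proof -
  have "(\<lambda>x. c *\<^sub>C x) ` closure commutator_vectors \<subseteq> closure commutator_vectors"
    by (intro image_closure_subset linear_continuous_on bounded_linear_scaleC closed_closure)
      (use closure_subset scaleC_commutator_vectors in blast)
  with assms show ?thesis by blast
qed

text \<open>\<open>commutator X Y\<close> is the adjoint of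
  \<open>commutator (adj Y) (adj X)\<close>, which kills \<open>z\<close>.\<close>

lemma orthogonal_commutator_vectors:
  assumes "\<And>X Y. X \<in> U \<Longrightarrow> Y \<in> U \<Longrightarrow> commutator X Y z = 0" "s \<in> closure commutator_vectors"
  shows "cinner z s = 0"
proof -
  have "commutator_vectors \<subseteq> {s. cinner z s = 0}"
    unfolding commutator_vectors_def
  proof (rule span_minimal)
    show "{commutator X Y h |X Y h. X \<in> U \<and> Y \<in> U} \<subseteq> {s. cinner z s = 0}"
    proof clarify
      fix X Y h assume "X \<in> U" "Y \<in> U"
      then show "cinner z (commutator X Y h) = 0"
        using assms(1)[of "adj Y" "adj X"] by (simp flip: adj_commutator cinner_adj_left)
    qed
    show "subspace {s. cinner z s = 0}"
      by (simp add: subspace_def cinner_add_right cinner_scaleR_right)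
  qed
  moreover have "closed {s. cinner z s = 0}"
    by (intro closed_Collect_eq bounded_bilinear.continuous_on[OF bounded_bilinear_cinner]
        continuous_intros)
  ultimately show ?thesis
    using assms(2) closure_minimal by blast
qed

lemma eq_0_if_commutators_vanish:
  assumes "\<And>X Y. X \<in> U \<Longrightarrow> Y \<in> U \<Longrightarrow> commutator X Y z = 0" "z \<in> closure commutator_vectors"
  shows "z = 0"
  using orthogonal_commutator_vectors[OF assms] by simp

lemma commutators_vanish_if_orthogonal:
  assumes "\<And>s. s \<in> closure commutator_vectors \<Longrightarrow> cinner z s = 0" "X \<in> U" "Y \<in> U"
  shows "commutator X Y z = 0"
proof -
  have "cinner (commutator X Y z) (commutator X Y z) = cinner z (adj (commutator X Y) (commutator X Y z))"
    using assms(2,3) by (simp add: cinner_adj_right)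
  moreover have "adj (commutator X Y) (commutator X Y z) \<in> closure commutator_vectors"
    using assms(2,3) by (auto simp: adj_commutator intro!: subsetD[OF closure_subset] commutator_vectorsI)
  then have "cinner z (adj (commutator X Y) (commutator X Y z)) = 0"
    by (rule assms(1))
  ultimately show ?thesis by simp
qed

lemma commutator_vectors_decomposition:
  obtains p where "p \<in> closure commutator_vectors" "norm p \<le> norm x"
    "\<And>X Y. X \<in> U \<Longrightarrow> Y \<in> U \<Longrightarrow> commutator X Y (x - p) = 0"
proof -
  obtain p where p: "p \<in> closure commutator_vectors"
      "\<And>s. s \<in> closure commutator_vectors \<Longrightarrow> cinner (x - p) s = 0"
    using orthogonal_projection_exists[OF closed_closure
        subspace_closure[OF subspace_commutator_vectors] scaleC_closure_commutator_vectors]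
    by metis
  have "(norm x)\<^sup>2 = (norm (x - p))\<^sup>2 + (norm p)\<^sup>2"
    using norm_add_squared[of "x - p" p] p by simp
  then have "(norm p)\<^sup>2 \<le> (norm x)\<^sup>2" by simp
  then have "norm p \<le> norm x" by (rule power2_le_imp_le) simp
  with p that commutators_vanish_if_orthogonal show thesis by blast
qed

end

section \<open>Construction of the multiplier and its centrality\<close>

context selfadjoint_commuting_map
begin

text \<open>The difference lies in the closed span and in its orthogonal complement. Linearity of
  the multiplier will follow by comparing brackets.\<close>

lemma multiplier_vector_unique:
  assumes "y \<in> closure commutator_vectors" "z \<in> closure commutator_vectors"
    and "\<And>X Y. X \<in> U \<Longrightarrow> Y \<in> U \<Longrightarrow> commutator X Y y = commutator X Y z"
  shows "y = z"
proof -
  have "y - z \<in> closure commutator_vectors"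
    using assms(1,2) subspace_closure[OF subspace_commutator_vectors]
    by (simp add: subspace_diff)
  moreover have "commutator X Y (y - z) = 0" if "X \<in> U" "Y \<in> U" for X Y
    using assms(3)[OF that] by (simp add: blinfun.diff_right)
  ultimately have "y - z = 0" by (rule eq_0_if_commutators_vanish[rotated])
  then show ?thesis by simp
qed

text \<open>For \<open>x\<close> in the span, replace every \<open>X i\<close> by
  \<open>f (X i)\<close> in a representing sum; \<open>commutator_exchange\<close> gives the bracket
  condition. The bound extends this to the closure, and the orthogonal part of \<open>x\<close>
  contributes nothing.\<close>

lemma multiplier_vector_exists:
  obtains C where "C > 0" "\<And>x. \<exists>y. y \<in> closure commutator_vectors \<and> norm y \<le> C * norm x \<and>
    (\<forall>X\<in>U. \<forall>Y\<in>U. commutator X Y y = commutator (f X) Y x)"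
proof -
  obtain C where C: "C > 0" "\<forall>(I :: 'h set) X Y h. finite I \<longrightarrow> (\<forall>i\<in>I. X i \<in> U \<and> Y i \<in> U) \<longrightarrow>
    norm (\<Sum>i\<in>I. commutator (f (X i)) (Y i) (h i)) \<le> C * norm (\<Sum>i\<in>I. commutator (X i) (Y i) (h i))"
    using sum_commutators_bounded by (elim exE conjE)
  have "\<exists>w \<in> closure commutator_vectors. norm w \<le> C * norm s \<and>
      (\<forall>X\<in>U. \<forall>Y\<in>U. commutator X Y w = commutator (f X) Y s)"
    if s: "s \<in> commutator_vectors" for s
  proof -
    obtain I :: "'h set" and X Y h where I: "finite I" "\<And>i. i \<in> I \<Longrightarrow> X i \<in> U \<and> Y i \<in> U"
        "s = (\<Sum>i\<in>I. commutator (X i) (Y i) (h i))"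
      using commutator_vectorsE[OF s] by metis
    let ?w = "\<Sum>i\<in>I. commutator (f (X i)) (Y i) (h i)"
    have "?w \<in> commutator_vectors"
      using I(2) by (intro subspace_sum subspace_commutator_vectors commutator_vectorsI) auto
    moreover have "commutator V Z ?w = commutator (f V) Z s" if "V \<in> U" "Z \<in> U" for V Z
      unfolding I(3) blinfun.sum_right using that I(2)
      by (intro sum.cong refl) (simp add: commutator_exchange)
    moreover have "norm ?w \<le> C * norm s"
      unfolding I(3) using C(2) I(1,2) by blast
    ultimately show ?thesis using closure_subset by blast
  qed
  then obtain w where w: "\<And>s. s \<in> commutator_vectors \<Longrightarrow> w s \<in> closure commutator_vectors"
      "\<And>s. s \<in> commutator_vectors \<Longrightarrow> norm (w s) \<le> C * norm s"
      "\<And>s X Y. s \<in> commutator_vectors \<Longrightarrow> X \<in> U \<Longrightarrow> Y \<in> U \<Longrightarrow>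
        commutator X Y (w s) = commutator (f X) Y s"
    by metis
  \<comment> \<open>\<open>w\<close> was chosen pointwise; uniqueness makes it additive, hence
    Lipschitz, so it preserves Cauchy sequences.\<close>
  have w_diff: "w s - w t = w (s - t)" if "s \<in> commutator_vectors" "t \<in> commutator_vectors" for s t
  proof (rule multiplier_vector_unique)
    have st: "s - t \<in> commutator_vectors"
      using that subspace_commutator_vectors by (simp add: subspace_diff)
    show "w (s - t) \<in> closure commutator_vectors" by (rule w(1)[OF st])
    show "w s - w t \<in> closure commutator_vectors"
      using w(1)[OF that(1)] w(1)[OF that(2)] subspace_closure[OF subspace_commutator_vectors]
      by (simp add: subspace_diff)
    fix X Y assume "X \<in> U" "Y \<in> U"
    then show "commutator X Y (w s - w t) = commutator X Y (w (s - t))"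
      using that st by (simp add: blinfun.diff_right w(3))
  qed
  have "\<exists>y. y \<in> closure commutator_vectors \<and> norm y \<le> C * norm x \<and>
    (\<forall>X\<in>U. \<forall>Y\<in>U. commutator X Y y = commutator (f X) Y x)" for x
  proof -
    obtain p where p: "p \<in> closure commutator_vectors" "norm p \<le> norm x"
        "\<And>X Y. X \<in> U \<Longrightarrow> Y \<in> U \<Longrightarrow> commutator X Y (x - p) = 0"
      by (rule commutator_vectors_decomposition[of x]) metis
    obtain s where s: "\<And>n. s n \<in> commutator_vectors" "s \<longlonglongrightarrow> p"
      using p(1) unfolding closure_sequential by blast
    have "Cauchy (\<lambda>n. w (s n))"
    proof (rule metric_CauchyI)
      fix e :: real assume "e > 0"
      then obtain M where M: "\<And>m n. m \<ge> M \<Longrightarrow> n \<ge> M \<Longrightarrow> dist (s m) (s n) < e / C"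
        using metric_CauchyD[OF LIMSEQ_imp_Cauchy[OF s(2)], of "e / C"] C(1) by auto
      have "dist (w (s m)) (w (s n)) < e" if "m \<ge> M" "n \<ge> M" for m n
      proof -
        have "dist (w (s m)) (w (s n)) \<le> C * dist (s m) (s n)"
          using s(1) subspace_commutator_vectors
          by (simp add: dist_norm w_diff w(2) subspace_diff)
        also have "\<dots> < e" using M[OF that] C(1) by (simp add: field_simps)
        finally show ?thesis .
      qed
      then show "\<exists>M. \<forall>m\<ge>M. \<forall>n\<ge>M. dist (w (s m)) (w (s n)) < e" by blast
    qed
    then obtain y where y: "(\<lambda>n. w (s n)) \<longlonglongrightarrow> y"
      using Cauchy_convergent_iff convergent_def by blast
    have "y \<in> closure commutator_vectors"
      using closed_sequentially[OF closed_closure _ y] w(1) s(1) by blast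
    moreover have "norm y \<le> C * norm p"
      by (rule LIMSEQ_le[OF tendsto_norm[OF y] tendsto_mult_left[OF tendsto_norm[OF s(2)]]])
        (use w(2) s(1) in blast)
    moreover have "commutator X Y y = commutator (f X) Y x" if "X \<in> U" "Y \<in> U" for X Y
    proof -
      have "(\<lambda>n. commutator X Y (w (s n))) \<longlonglongrightarrow> commutator X Y y"
        by (intro tendsto_intros y)
      moreover have "(\<lambda>n. commutator (f X) Y (s n)) \<longlonglongrightarrow> commutator (f X) Y p"
        by (intro tendsto_intros s)
      ultimately have "commutator X Y y = commutator (f X) Y p"
        using w(3)[OF s(1) that] LIMSEQ_unique by force
      then show ?thesis
        using p(3)[of "f X" Y] that by (simp add: blinfun.diff_right)
    qed
    ultimately show ?thesis
      using p(2) C(1) by (meson mult_left_mono less_imp_le order_trans)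
  qed
  with C(1) that show thesis by blast
qed

lemma multiplier_exists:
  obtains T where "T \<in> bounded_operators" "\<And>x. T x \<in> closure commutator_vectors"
    "\<And>X Y x. X \<in> U \<Longrightarrow> Y \<in> U \<Longrightarrow> commutator X Y (T x) = commutator (f X) Y x"
proof -
  obtain C where C: "C > 0" "\<And>x. \<exists>y. y \<in> closure commutator_vectors \<and> norm y \<le> C * norm x \<and>
    (\<forall>X\<in>U. \<forall>Y\<in>U. commutator X Y y = commutator (f X) Y x)"
    by (rule multiplier_vector_exists) metis
  then obtain t where t: "\<And>x. t x \<in> closure commutator_vectors" "\<And>x. norm (t x) \<le> C * norm x"
      "\<And>X Y x. X \<in> U \<Longrightarrow> Y \<in> U \<Longrightarrow> commutator X Y (t x) = commutator (f X) Y x"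
    by metis
  note sub = subspace_closure[OF subspace_commutator_vectors]
  have "bounded_linear t"
  proof (rule bounded_linear_intro)
    show "norm (t x) \<le> norm x * C" for x using t(2)[of x] by (simp add: mult.commute)
    show "t (x + y) = t x + t y" for x y
      by (rule multiplier_vector_unique)
        (auto simp: t subspace_add[OF sub] blinfun.add_right)
    show "t (r *\<^sub>R x) = r *\<^sub>R t x" for r x
      by (rule multiplier_vector_unique)
        (auto simp: t subspace_scale[OF sub] blinfun.scaleR_right)
  qed
  then have T: "blinfun_apply (Blinfun t) = t"
    by (rule bounded_linear_Blinfun_apply)
  have "t (c *\<^sub>C x) = c *\<^sub>C t x" for c x
    by (rule multiplier_vector_unique)
      (simp_all add: t scaleC_closure_commutator_vectors scaleC_apply)
  then have "Blinfun t \<in> bounded_operators"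
    by (simp add: bounded_operators_def T)
  with that[of "Blinfun t"] t show thesis by (simp add: T)
qed

text \<open>The hypothesis applies a commutator after \<open>T\<close>; uniqueness allows
  \<open>T\<close> to be applied after it. Hence \<open>T\<close> composed with a commutator of
  \<open>U\<close> stays in \<open>U\<close>.\<close>

lemma multiplier_commutator:
  fixes T :: "'h \<Rightarrow>\<^sub>L 'h"
  assumes T: "\<And>x. T x \<in> closure commutator_vectors"
    "\<And>X Y x. X \<in> U \<Longrightarrow> Y \<in> U \<Longrightarrow> commutator X Y (blinfun_apply T x) = commutator (f X) Y x"
    and X: "X \<in> U" "Y \<in> U"
  shows "T (commutator X Y h) = commutator (f X) Y h"
proof (rule multiplier_vector_unique[OF T(1)])
  show "commutator (f X) Y h \<in> closure commutator_vectors"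
    using X closure_subset commutator_vectorsI[of "f X" Y] by auto
  show "commutator V Z (T (commutator X Y h)) = commutator V Z (commutator (f X) Y h)"
    if "V \<in> U" "Z \<in> U" for V Z
    using that X T(2) by (simp add: commutator_exchange)
qed

text \<open>\<open>T o\<^sub>L a\<close> lies in \<open>U\<close> when \<open>a\<close> is a
  multiple of a sum of \<open>S o\<^sub>L adj S\<close> over commutators \<open>S\<close>. So does
  \<open>T\<close> composed with the approximate unit, which is close to \<open>T\<close> on the
  finite set \<open>K\<close>.\<close>

lemma multiplier_in:
  assumes T: "T \<in> bounded_operators" "\<And>x. T x \<in> closure commutator_vectors"
    "\<And>X Y x. X \<in> U \<Longrightarrow> Y \<in> U \<Longrightarrow> commutator X Y (blinfun_apply T x) = commutator (f X) Y x"
  shows "T \<in> U"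
proof (rule weakly_closed[OF T(1)])
  fix K :: "'h set" and e :: real assume K: "finite K" and e: "e > 0"
  have T_0: "T q = 0" if "\<And>X Y. X \<in> U \<Longrightarrow> Y \<in> U \<Longrightarrow> commutator X Y q = 0" for q
    by (rule eq_0_if_commutators_vanish) (simp_all add: T that)
  \<comment> \<open>Two errors below \<open>d\<close> will pass through \<open>T\<close>;
    \<open>norm T + 1\<close> makes the final estimate strict and avoids dividing by 0.\<close>
  define d where "d = e / (2 * (norm T + 1))"
  have nT: "norm T + 1 > 0" by (simp add: add_nonneg_pos)
  then have d: "d > 0" using e by (simp add: d_def)
  have "\<exists>p s. s \<in> commutator_vectors \<and> norm (p - s) < d \<and>
      (\<forall>X\<in>U. \<forall>Y\<in>U. commutator X Y (x - p) = 0)" for x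
  proof -
    obtain p where "p \<in> closure commutator_vectors"
      "\<And>X Y. X \<in> U \<Longrightarrow> Y \<in> U \<Longrightarrow> commutator X Y (x - p) = 0"
      by (rule commutator_vectors_decomposition[of x]) metis
    then show ?thesis
      using d unfolding closure_approachable by (metis dist_commute dist_norm)
  qed
  then obtain p s where ps: "\<And>x. s x \<in> commutator_vectors" "\<And>x. norm (p x - s x) < d"
      "\<And>x X Y. X \<in> U \<Longrightarrow> Y \<in> U \<Longrightarrow> commutator X Y (x - p x) = 0"
    by metis
  have "\<forall>x. \<exists>(I :: 'h set) X Y h. finite I \<and> (\<forall>i\<in>I. X i \<in> U \<and> Y i \<in> U) \<and>
      s x = (\<Sum>i\<in>I. commutator (X i) (Y i) (h i))"
  proof
    fix x
    show "\<exists>(I :: 'h set) X Y h. finite I \<and> (\<forall>i\<in>I. X i \<in> U \<and> Y i \<in> U) \<and>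
        s x = (\<Sum>i\<in>I. commutator (X i) (Y i) (h i))"
      by (rule commutator_vectorsE[OF ps(1)[of x]]) blast
  qed
  then obtain I :: "'h \<Rightarrow> 'h set" and X Y h where
      IXYh: "\<forall>x. finite (I x) \<and> (\<forall>i\<in>I x. X x i \<in> U \<and> Y x i \<in> U) \<and>
        s x = (\<Sum>i\<in>I x. commutator (X x i) (Y x i) (h x i))"
    unfolding choice_iff by (elim exE)
  then have I: "finite (I x)" "i \<in> I x \<Longrightarrow> X x i \<in> U \<and> Y x i \<in> U"
      "s x = (\<Sum>i\<in>I x. commutator (X x i) (Y x i) (h x i))" for x i
    by simp_all
  \<comment> \<open>All commutators representing the approximants \<open>s x\<close> for
    \<open>x\<close> in \<open>K\<close> are collected, so that one \<open>a\<close> serves the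
    whole finite set.\<close>
  define P where "P = (\<lambda>(x, i). commutator (X x i) (Y x i)) ` (SIGMA x:K. I x)"
  have P_comm: "\<exists>V\<in>U. \<exists>Z\<in>U. S = commutator V Z" if "S \<in> P" for S
    using that I(2) unfolding P_def by fastforce
  have "finite P" "P \<subseteq> U"
    using K I(1,2) by (auto simp: P_def)
  then obtain N where N: "N > 0" "positive_contraction ((1 / N) *\<^sub>R (\<Sum>S\<in>P. S o\<^sub>L adj S))"
    "\<And>S x. S \<in> P \<Longrightarrow>
      (norm (adj S x))\<^sup>2 \<le> N * Re (cinner (((1 / N) *\<^sub>R (\<Sum>S\<in>P. S o\<^sub>L adj S)) x) x)"
    using positive_contraction_sum by blast
  define a where "a = (1 / N) *\<^sub>R (\<Sum>S\<in>P. S o\<^sub>L adj S)"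
  interpret positive_contraction a using N(2) by (simp add: a_def)
  have aU: "a \<in> U"
    unfolding a_def using \<open>P \<subseteq> U\<close> by (intro scaleR_in sum_in compose_in adj_in) auto
  have TS: "T o\<^sub>L S \<in> U" if S: "S \<in> P" for S
  proof -
    obtain V Z where VZ: "V \<in> U" "Z \<in> U" "S = commutator V Z" using P_comm[OF S] by blast
    then have "T o\<^sub>L S = commutator (f V) Z"
      by (intro blinfun_eqI) (simp add: multiplier_commutator[OF T(2,3)])
    then show ?thesis using VZ by simp
  qed
  have "T o\<^sub>L a = (1 / N) *\<^sub>R (\<Sum>S\<in>P. (T o\<^sub>L S) o\<^sub>L adj S)"
    by (rule blinfun_eqI) (simp add: a_def blinfun_simps blinfun.sum_left blinfun.sum_right)
  moreover have "(T o\<^sub>L S) o\<^sub>L adj S \<in> U" if "S \<in> P" for S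
    using TS[OF that] \<open>P \<subseteq> U\<close> that by (meson adj_in compose_in subsetD)
  ultimately have TaU: "T o\<^sub>L a \<in> U"
    by (simp add: sum_in)
  have unit: "\<exists>A\<in>U. \<forall>x. A x = T (x - complement_power n x)" for n
  proof -
    \<comment> \<open>\<open>B\<close> carries the power of 1 - a itself: passing from n to n + 1
      adds a (1 - a)^n to the approximate unit.\<close>
    have "\<exists>A\<in>U. \<exists>B\<in>U. \<forall>x. A x = T (x - complement_power n x) \<and> B x = complement_power n x"
    proof (induction n)
      case 0
      show ?case by (intro bexI[of _ 0] bexI[of _ id_blinfun]) simp_all
    next
      case (Suc n)
      then obtain A B where "A \<in> U" "B \<in> U"
        "\<And>x. A x = T (x - complement_power n x)" "\<And>x. B x = complement_power n x" by blast
      then show ?case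
        using TaU aU by (intro bexI[of _ "A + ((T o\<^sub>L a) o\<^sub>L B)"] bexI[of _ "B - (a o\<^sub>L B)"])
          (auto simp: complement_power_Suc blinfun_simps)
    qed
    then show ?thesis by blast
  qed
  have "(\<lambda>n. complement_power n (s x)) \<longlonglongrightarrow> 0" if x: "x \<in> K" for x
  proof -
    have "(\<lambda>n. complement_power n (commutator (X x i) (Y x i) (h x i))) \<longlonglongrightarrow> 0"
      if i: "i \<in> I x" for i
    proof (rule complement_power_tendsto_0)
      have "commutator (X x i) (Y x i) \<in> P" using x i by (force simp: P_def)
      then show "is_adjoint (commutator (X x i) (Y x i)) (adj (commutator (X x i) (Y x i)))"
        "(norm (adj (commutator (X x i) (Y x i)) y))\<^sup>2 \<le> N * Re (cinner (a y) y)" for y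
        using adj_exists N(3) \<open>P \<subseteq> U\<close> unfolding a_def by blast+
    qed
    then have "(\<lambda>n. \<Sum>i\<in>I x. complement_power n (commutator (X x i) (Y x i) (h x i))) \<longlonglongrightarrow> 0"
      by (rule tendsto_null_sum)
    moreover have "complement_power n (\<Sum>i\<in>J. g i) = (\<Sum>i\<in>J. complement_power n (g i))"
      for n and J :: "'h set" and g
      by (induction n) (simp_all add: complement_power_Suc blinfun.sum_right sum_subtractf)
    ultimately show ?thesis by (simp add: I(3))
  qed
  then have "eventually (\<lambda>n. \<forall>x\<in>K. norm (complement_power n (s x)) < d) sequentially"
    using K d by (intro eventually_ball_finite) (auto simp: tendsto_iff)
  then obtain n where n: "\<And>x. x \<in> K \<Longrightarrow> norm (complement_power n (s x)) < d"
    using eventually_happens'[OF sequentially_bot] by blast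
  obtain A where A: "A \<in> U" "\<And>x. A x = T (x - complement_power n x)"
    using unit by blast
  have "norm (A x - T x) < e" if x: "x \<in> K" for x
  proof -
    let ?q = "x - p x"
    \<comment> \<open>The part \<open>x - p x\<close> is fixed by the powers of 1 - a and killed by
      \<open>T\<close>, so only \<open>p x\<close> contributes to the error.\<close>
    have "adj S ?q = 0" if "S \<in> P" for S
      using P_comm[OF that] ps(3) by (auto simp: adj_commutator)
    then have "a ?q = 0"
      by (simp add: a_def blinfun.scaleR_left blinfun.sum_left)
    then have "complement_power n ?q = ?q"
      by (induction n) (simp_all add: complement_power_Suc)
    then have "T (complement_power n ?q) = 0" using T_0 ps(3) by simp
    then have "T (complement_power n x) = T (complement_power n (p x))"
      by (simp add: complement_power_diff blinfun.diff_right)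
    then have "norm (A x - T x) = norm (T (complement_power n (p x)))"
      by (simp add: A(2) blinfun.diff_right)
    also have "\<dots> \<le> norm T * norm (complement_power n (p x))"
      by (rule norm_blinfun)
    also have "norm (complement_power n (p x))
        \<le> norm (complement_power n (p x - s x)) + norm (complement_power n (s x))"
      by (simp add: complement_power_diff) (metis diff_add_cancel norm_triangle_ineq)
    also have "\<dots> \<le> 2 * d"
      using norm_complement_power_le[of n "p x - s x"] ps(2)[of x] n[OF x] by linarith
    also have "norm T * (2 * d) < (norm T + 1) * (2 * d)" using d by simp
    also have "\<dots> = e" using nT by (simp add: d_def field_simps)
    finally show ?thesis by (simp add: mult_left_mono)
  qed
  with A(1) show "\<exists>A\<in>U. \<forall>x\<in>K. norm (A x - T x) < e" by blast
qed

lemma central_multiplier: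
  obtains W where "W \<in> center U" "\<And>X. X \<in> U \<Longrightarrow> f X - (W o\<^sub>L X) \<in> center U"
proof -
  obtain T where T: "T \<in> bounded_operators" "\<And>x. T x \<in> closure commutator_vectors"
    "\<And>X Y x. X \<in> U \<Longrightarrow> Y \<in> U \<Longrightarrow> commutator X Y (T x) = commutator (f X) Y x"
    by (rule multiplier_exists) metis
  have TU: "T \<in> U" by (rule multiplier_in[OF T])
  note T_comm = multiplier_commutator[OF T(2,3)]
  have "commutator T Y = 0" if Y: "Y \<in> U" for Y
  proof -
    \<comment> \<open>\<open>Y\<close> times a commutator is a combination of commutators, so
      \<open>T\<close> acts on it through \<open>f\<close>; moving \<open>f\<close> by
      \<open>comm\<close> shows that \<open>T\<close> and \<open>Y\<close> commute there.\<close>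
    have kill: "commutator T Y (commutator V Z h) = 0" if VZ: "V \<in> U" "Z \<in> U" for V Z h
    proof -
      have "Y (commutator V Z h) = commutator (Y o\<^sub>L V) Z h - commutator Y Z (V h)"
        by (simp add: commutator_compose_left blinfun_simps)
      then have "T (Y (commutator V Z h)) = commutator (f (Y o\<^sub>L V)) Z h - commutator (f Y) Z (V h)"
        using VZ Y by (simp add: blinfun.diff_right T_comm)
      also have "\<dots> = Y (commutator (f V) Z h)"
        using VZ Y by (simp add: comm commutator_compose_left blinfun_simps)
      finally show ?thesis
        using VZ by (simp add: commutator_apply[of T Y] T_comm)
    qed
    have "adj (commutator T Y) y = 0" for y
    proof -
      have "cinner (adj (commutator T Y) y) (adj (commutator T Y) y)
          = cinner (commutator T Y (adj (commutator T Y) y)) y"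
        using TU Y by (simp add: cinner_adj_right)
      also have "commutator T Y (adj (commutator T Y) y) = 0"
        using TU Y by (simp add: adj_commutator kill)
      finally show ?thesis by simp
    qed
    then have "cinner (commutator T Y x) (commutator T Y x) = 0" for x
      using TU Y by (metis cinner_adj_right cinner_zero_right commutator_in)
    then show ?thesis by (intro blinfun_eqI) simp
  qed
  with TU have T_center: "T \<in> center U" by (simp add: center_iff)
  moreover have "f X - (T o\<^sub>L X) \<in> center U" if X: "X \<in> U" for X
  proof -
    have "commutator (T o\<^sub>L X) Y = commutator (f X) Y" if Y: "Y \<in> U" for Y
      using X Y T_comm by (intro blinfun_eqI)
        (simp add: commutator_compose_left center_centralizes[OF T_center] blinfun_simps)
    then show ?thesis
      using X TU by (simp add: center_iff commutator_diff_left)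
  qed
  ultimately show thesis by (rule that)
qed

end

section \<open>Lie centralizers\<close>

context commuting_map
begin

text \<open>Take adjoints in \<open>comm\<close> for \<open>adj Y\<close> and
  \<open>adj X\<close>.\<close>

lemma commuting_map_adjoint: "commuting_map U (\<lambda>X. adj (f (adj X)))"
proof unfold_locales
  fix X Y assume "X \<in> U" "Y \<in> U"
  then show "commutator (adj (f (adj X))) Y = commutator X (adj (f (adj Y)))"
    using comm[of "adj Y" "adj X"] adj_commutator[of "adj Y" "f (adj X)"]
      adj_commutator[of "f (adj Y)" "adj X"] by simp
qed simp

text \<open>The general case reduces to the self-adjoint one by writing \<open>f\<close> as the sum of its real part
  and \<open>\<i>\<close> times its imaginary part with respect to \<open>X \<mapsto> (f X\<^sup>*)\<^sup>*\<close>.\<close>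

lemma central_multiplier_commuting:
  obtains W where "W \<in> center U" "\<And>X. X \<in> U \<Longrightarrow> f X - (W o\<^sub>L X) \<in> center U"
proof -
  define g where "g X = adj (f (adj X))" for X
  interpret g: commuting_map U g
    unfolding g_def by (rule commuting_map_adjoint)
  have adj_g: "adj (g X) = f (adj X)" "adj (f X) = g (adj X)" if "X \<in> U" for X
    using that by (simp_all add: g_def)
  define re where "re X = scaleC_op (1/2) (f X + g X)" for X
  \<comment> \<open>This is (f - g) / (2 i), as 1 / (2 i) = - i / 2.\<close>
  define im where "im X = scaleC_op (\<i>/2) (g X - f X)" for X
  have scaleC_left: "commutator (scaleC_op c X) Y = scaleC_op c (commutator X Y)"
    and scaleC_right: "commutator X (scaleC_op c Y) = scaleC_op c (commutator X Y)"
    if "X \<in> U" "Y \<in> U" for c X Y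
    using that by (auto intro!: blinfun_eqI simp: commutator_apply scaleC_apply scaleC_diff_right)
  interpret re: selfadjoint_commuting_map U re
  proof unfold_locales
    fix X assume X: "X \<in> U"
    then show "re X \<in> U" by (simp add: re_def)
    show "adj (re X) = re (adj X)"
      using X by (simp add: re_def adj_scaleC adj_add adj_g add.commute)
    fix Y assume "Y \<in> U"
    with X show "commutator (re X) Y = commutator X (re Y)"
      by (simp add: re_def scaleC_left scaleC_right commutator_add_left commutator_add_right
          comm g.comm)
  qed
  interpret im: selfadjoint_commuting_map U im
  proof unfold_locales
    fix X assume X: "X \<in> U"
    then show "im X \<in> U" by (simp add: im_def)
    have "scaleC_op (cnj (\<i>/2)) (f (adj X) - g (adj X)) = scaleC_op (\<i>/2) (g (adj X) - f (adj X))"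
    proof (rule blinfun_eqI)
      fix x
      have "(- c) *\<^sub>C (y - z) = c *\<^sub>C (z - y)" for c and y z :: 'h
        by (metis minus_diff_eq mult_minus1_right scaleC_minus_one scaleC_scaleC)
      from this[of "\<i>/2"] show "scaleC_op (cnj (\<i>/2)) (f (adj X) - g (adj X)) x
          = scaleC_op (\<i>/2) (g (adj X) - f (adj X)) x"
        by (simp add: blinfun.diff_left)
    qed
    then show "adj (im X) = im (adj X)"
      using X by (simp add: im_def adj_scaleC adj_diff adj_g)
    fix Y assume "Y \<in> U"
    with X show "commutator (im X) Y = commutator X (im Y)"
      by (simp add: im_def scaleC_left scaleC_right commutator_diff_left commutator_diff_right
          comm g.comm)
  qed
  have split: "f X = re X + scaleC_op \<i> (im X)" for X
  proof (rule blinfun_eqI)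
    fix x
    have "(1/2) *\<^sub>C (y + z) + \<i> *\<^sub>C (\<i>/2) *\<^sub>C (z - y) = y" for y z :: 'h
    proof -
      have "\<i> *\<^sub>C (\<i>/2) *\<^sub>C (z - y) = (1/2) *\<^sub>C (y - z)"
        by (simp add: scaleC_scaleC) (metis minus_diff_eq mult_minus1_right scaleC_minus_one scaleC_scaleC)
      then have "(1/2) *\<^sub>C (y + z) + \<i> *\<^sub>C (\<i>/2) *\<^sub>C (z - y) = (1/2) *\<^sub>C (y + y)"
        by (simp flip: scaleC_add_right)
      also have "\<dots> = y"
        by (simp add: scaleC_add_right flip: scaleC_add_left)
      finally show ?thesis .
    qed
    then show "f X x = (re X + scaleC_op \<i> (im X)) x"
      by (simp add: re_def im_def blinfun_simps)
  qed
  obtain V where V: "V \<in> center U" "\<And>X. X \<in> U \<Longrightarrow> re X - (V o\<^sub>L X) \<in> center U"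
    by (rule re.central_multiplier) metis
  obtain W where W: "W \<in> center U" "\<And>X. X \<in> U \<Longrightarrow> im X - (W o\<^sub>L X) \<in> center U"
    by (rule im.central_multiplier) metis
  show thesis
  proof (rule that)
    show "V + scaleC_op \<i> W \<in> center U"
      by (intro center_add center_scaleC V W)
    fix X assume X: "X \<in> U"
    have "f X - ((V + scaleC_op \<i> W) o\<^sub>L X) = (re X - (V o\<^sub>L X)) + scaleC_op \<i> (im X - (W o\<^sub>L X))"
      by (rule blinfun_eqI) (simp add: split[of X] blinfun_simps scaleC_diff_right)
    then show "f X - ((V + scaleC_op \<i> W) o\<^sub>L X) \<in> center U"
      using V(2)[OF X] W(2)[OF X] by (simp add: center_add center_scaleC)
  qed
qed

end

theorem corollary2p2:
  fixes n :: nat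
    and U :: "('h::complex_hilbert_space \<Rightarrow>\<^sub>L 'h) set"
    and \<phi> :: "('h \<Rightarrow>\<^sub>L 'h) \<Rightarrow> ('h \<Rightarrow>\<^sub>L 'h)"
  assumes "n \<ge> 2"
    and "von_neumann_algebra U"
    and "additive_map U U \<phi>"
  shows "lie_centralizer n U \<phi> \<longleftrightarrow>
    (\<exists>W \<xi>. W \<in> center U \<and> additive_map U (center U) \<xi> \<and>
       (\<forall>A\<in>U. \<phi> A = (W o\<^sub>L A) + \<xi> A) \<and>
       (\<forall>A. (\<forall>i\<in>{1..n}. A i \<in> U) \<longrightarrow> \<xi> (lie_poly n A) = 0))"
proof -
  interpret von_neumann U by unfold_locales (rule assms(2))
  have phi: "\<And>A. A \<in> U \<Longrightarrow> \<phi> A \<in> U" "\<And>A B. A \<in> U \<Longrightarrow> B \<in> U \<Longrightarrow> \<phi> (A + B) = \<phi> A + \<phi> B"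
    using assms(3) by (auto simp: additive_map_def)
  \<comment> \<open>The central \<open>W\<close> factors out of every bracket, and the central
    summand \<open>Z\<close> contributes 0 because \<open>n \<ge> 2\<close>. In both directions the
    centralizer identity at \<open>A\<close> thus amounts to
    \<open>\<xi> (lie_poly n A) = 0\<close>.\<close>
  have first: "lie_poly n (A(1 := \<phi> (A 1))) = W o\<^sub>L lie_poly n A"
    if "W \<in> center U" "\<phi> (A 1) = (W o\<^sub>L A 1) + Z" "Z \<in> center U" "\<forall>i\<in>{1..n}. A i \<in> U" for W Z A
    using that assms(1)
    by (simp only: lie_poly_add_first lie_poly_compose_first lie_poly_central_first) simp
  show ?thesis
  proof
    assume lie: "lie_centralizer n U \<phi>"
    interpret commuting_map U \<phi>
      by unfold_locales (use phi lie_centralizer_commuting[OF assms(1,3) lie] in auto)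
    obtain W where W: "W \<in> center U" "\<And>X. X \<in> U \<Longrightarrow> \<phi> X - (W o\<^sub>L X) \<in> center U"
      by (rule central_multiplier_commuting) metis
    define \<xi> where "\<xi> X = \<phi> X - (W o\<^sub>L X)" for X
    have "additive_map U (center U) \<xi>"
      using W(2) by (auto simp: additive_map_def \<xi>_def phi 
          bounded_bilinear.add_right[OF bounded_bilinear_blinfun_compose])
    moreover have "\<xi> (lie_poly n A) = 0" if A: "\<forall>i\<in>{1..n}. A i \<in> U" for A
    proof -
      have A1: "A 1 \<in> U" using A assms(1) by simp
      have "\<phi> (lie_poly n A) = lie_poly n (A(1 := \<phi> (A 1)))"
        using lie A by (simp add: lie_centralizer_def)
      also have "\<dots> = W o\<^sub>L lie_poly n A"
        by (rule first[OF W(1) _ W(2)[OF A1] A]) simp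
      finally show ?thesis by (simp add: \<xi>_def)
    qed
    ultimately show "\<exists>W \<xi>. W \<in> center U \<and> additive_map U (center U) \<xi> \<and>
       (\<forall>A\<in>U. \<phi> A = (W o\<^sub>L A) + \<xi> A) \<and>
       (\<forall>A. (\<forall>i\<in>{1..n}. A i \<in> U) \<longrightarrow> \<xi> (lie_poly n A) = 0)"
      using W(1) by (intro exI[of _ W] exI[of _ \<xi>]) (simp add: \<xi>_def)
  next
    assume "\<exists>W \<xi>. W \<in> center U \<and> additive_map U (center U) \<xi> \<and>
       (\<forall>A\<in>U. \<phi> A = (W o\<^sub>L A) + \<xi> A) \<and>
       (\<forall>A. (\<forall>i\<in>{1..n}. A i \<in> U) \<longrightarrow> \<xi> (lie_poly n A) = 0)"
    then obtain W \<xi> where W: "W \<in> center U" "additive_map U (center U) \<xi>"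
        "\<And>A. A \<in> U \<Longrightarrow> \<phi> A = (W o\<^sub>L A) + \<xi> A"
        "\<And>A. \<forall>i\<in>{1..n}. A i \<in> U \<Longrightarrow> \<xi> (lie_poly n A) = 0" by blast
    show "lie_centralizer n U \<phi>"
      unfolding lie_centralizer_def
    proof (intro allI impI)
      fix A :: "nat \<Rightarrow> 'h \<Rightarrow>\<^sub>L 'h" assume A: "\<forall>i\<in>{1..n}. A i \<in> U"
      have A1: "A 1 \<in> U" using A assms(1) by simp
      then have "\<xi> (A 1) \<in> center U" using W(2) by (auto simp: additive_map_def)
      then have "lie_poly n (A(1 := \<phi> (A 1))) = W o\<^sub>L lie_poly n A"
        by (rule first[OF W(1) W(3)[OF A1] _ A])
      moreover have "lie_poly n A \<in> U" using A by (intro lie_poly_in) auto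
      ultimately show "\<phi> (lie_poly n A) = lie_poly n (A(1 := \<phi> (A 1)))"
        using W(3,4) A by simp
    qed
  qed
qed

end
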